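(* Let $(X_\bullet,c_{X_\bullet})$ and $(Y_\bullet,c_{Y_\bullet})$ be $\mathbb{R}$-filtrations of closure spaces, let $\mathbf{D}$ be a category, and let $H:\mathbf{Cl}\to\mathbf{D}$ be a $(J_\top,\times)$-homotopy invariant functor. Then $$d_I\big(H(X_\bullet,c_{X_\bullet}),H(Y_\bullet,c_{Y_\bullet})\big)\le 2\,d_{GH}\big((X_\bullet,c_{X_\bullet}),(Y_\bullet,c_{Y_\bullet})\big),$$ where $d_I$ denotes the interleaving distance and $d_{GH}$ the Gromov–Hausdorff distance for $\mathbb{R}$-filtrations of closure spaces.
   Context: A (Čech) closure space $(X,c)$ is a set $X$ with a function $c:2^X\to 2^X$ such that $c(\varnothing)=\varnothing$, $A\subset c(A)$, and $c(A\cup B)=c(A)\cup c(B)$. A map $f:(X,c_X)\to(Y,c_Y)$ is continuous if $f(c_X(A))\subset c_Y(f(A))$ for all $A\subset X$; $\mathbf{Cl}$ is the category of closure spaces and continuous maps (it is cocomplete; its monomorphisms are the injective continuous maps). A set $U$ is a neighborhood of $x$ if $x\notin c(X\setminus U)$. The product closure on $X\times Y$ is $(c_X\times c_Y)(A)=\{(x,y)\mid (U\times V)\cap A\neq\varnothing$ for all neighborhoods $U$ of $x$, $V$ of $y\}$. $J_\top=\{0,1\}$ with the indiscrete closure. Continuous $f,g:X\to Y$ are one-step $(J_\top,\times)$-homotopic if there is a continuous $H:X\times J_\top\to Y$ with $H(x,0)=f(x)$, $H(x,1)=g(x)$; $\sim_{(J_\top,\times)}$ is the equivalence relation generated by this.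 A functor $H:\mathbf{Cl}\to\mathbf{D}$ is $(J_\top,\times)$-homotopy invariant if $f\sim_{(J_\top,\times)}g$ implies $H(f)=H(g)$. An $\mathbb{R}$-filtration of closure spaces is a functor $X_\bullet:(\mathbb{R},\le)\to\mathbf{Cl}$ sending each $s\le t$ to a monomorphism. It is an $\mathbb{R}$-filtered closure space if these maps are subset inclusions $X_s\subset X_t$; then write $X=\bigcup_tX_t$. Every $\mathbb{R}$-filtration $X_\bullet$ is isomorphic to an $\mathbb{R}$-filtered closure space $X'_\bullet$ obtained by choosing a colimit of $X_\bullet$ and letting $X'_t$ be the image of $X_t$ in it (with closure transported from $X_t$). A multivalued map $C:X\rightrightarrows Y$ is a subset $C\subset X\times Y$ projecting onto $X$; write $xCy$ for $(x,y)\in C$, $C(A)=\{y\mid\exists a\in A,\ aCy\}$. It is a correspondence if it also projects onto $Y$; $C^T=\{(y,x)\mid xCy\}$. A function $f:X\to Y$ is subordinate to $C$ if $xCf(x)$ for all $x$. For $\mathbb{R}$-filtered closure spaces and $\varepsilon\ge0$, a multivalued map $C:X\rightrightarrows Y$ is an $\varepsilon$-multivalued map if for all $t$: (1) $x\in X_t$ and $xCy$ imply $y\in Y_{t+\varepsilon}$; (2) for all $A\subset X_t$ and all $f$ subordinate to $C$, $C(c_{X_t}(A))\subset c_{Y_{t+\varepsilon}}(f(A))$. A correspondence $C$ is an $\varepsilon$-correspondence if $C$ and $C^T$ are $\varepsilon$-multivalued maps. $\mathrm{dist}(C)=\inf\{\varepsilon\ge0\mid C$ is an $\varepsilon$-correspondence$\}$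 ($\infty$ if none). For $\mathbb{R}$-filtered closure spaces, $d_{GH}(X_\bullet,Y_\bullet)=\frac12\inf_C\mathrm{dist}(C)$ over all correspondences $C:X\rightrightarrows Y$; for $\mathbb{R}$-filtrations, $d_{GH}(X_\bullet,Y_\bullet):=d_{GH}(X'_\bullet,Y'_\bullet)$ (well defined since $d_{GH}$ is isomorphism invariant). Functors $M,N:(\mathbb{R},\le)\to\mathbf{D}$ are $\varepsilon$-interleaved if there are maps $\varphi_p:M_p\to N_{p+\varepsilon}$, $\psi_p:N_p\to M_{p+\varepsilon}$, natural in $p$, with $\psi_{p+\varepsilon}\varphi_p=M_{p\le p+2\varepsilon}$ and $\varphi_{p+\varepsilon}\psi_p=N_{p\le p+2\varepsilon}$; $d_I(M,N)=\inf\{\varepsilon\ge 0\mid M,N$ are $\varepsilon$-interleaved$\}$. $H(X_\bullet,c_{X_\bullet})$ is $H$ applied elementwise. *)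

theory Defs
  imports "HOL-Library.FuncSet" "HOL-Library.Extended_Nonnegative_Real"
begin

section \<open>Categories and functors\<close>

record ('o, 'm) category =
  Obj :: "'o set"
  Arr :: "'m set"
  Dom :: "'m \<Rightarrow> 'o"
  Cod :: "'m \<Rightarrow> 'o"
  Id :: "'o \<Rightarrow> 'm"
  Comp :: "'m \<Rightarrow> 'm \<Rightarrow> 'm"  \<comment> \<open>\<open>Comp C g f\<close> is \<open>g\<close> after \<open>f\<close>\<close>

definition Hom :: "('o, 'm) category \<Rightarrow> 'o \<Rightarrow> 'o \<Rightarrow> 'm set" where
  "Hom C a b = {f \<in> Arr C. Dom C f = a \<and> Cod C f = b}"

locale category =
  fixes C :: "('o, 'm) category"
  assumes Dom_Obj: "f \<in> Arr C \<Longrightarrow> Dom C f \<in> Obj C"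
    and Cod_Obj: "f \<in> Arr C \<Longrightarrow> Cod C f \<in> Obj C"
    and Id_Hom: "a \<in> Obj C \<Longrightarrow> Id C a \<in> Hom C a a"
    and Comp_Hom: "f \<in> Hom C a b \<Longrightarrow> g \<in> Hom C b c \<Longrightarrow> Comp C g f \<in> Hom C a c"
    and Comp_Id_right: "f \<in> Hom C a b \<Longrightarrow> Comp C f (Id C a) = f"
    and Comp_Id_left: "f \<in> Hom C a b \<Longrightarrow> Comp C (Id C b) f = f"
    and Comp_assoc: "f \<in> Hom C a b \<Longrightarrow> g \<in> Hom C b c \<Longrightarrow> h \<in> Hom C c d \<Longrightarrow>
      Comp C h (Comp C g f) = Comp C (Comp C h g) f"

definition monomorphism :: "('o, 'm) category \<Rightarrow> 'm \<Rightarrow> bool" where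
  "monomorphism C f \<longleftrightarrow> f \<in> Arr C \<and>
    (\<forall>g\<in>Arr C. \<forall>h\<in>Arr C. Cod C g = Dom C f \<and> Cod C h = Dom C f \<and> Dom C g = Dom C h \<and>
      Comp C f g = Comp C f h \<longrightarrow> g = h)"

record ('o, 'm, 'p, 'n) ftor =
  on_obj :: "'o \<Rightarrow> 'p"
  on_arr :: "'m \<Rightarrow> 'n"

definition is_functor ::
  "('o, 'm) category \<Rightarrow> ('p, 'n) category \<Rightarrow> ('o, 'm, 'p, 'n) ftor \<Rightarrow> bool" where
  "is_functor C D F \<longleftrightarrow>
    (\<forall>a\<in>Obj C. on_obj F a \<in> Obj D) \<and>
    (\<forall>a\<in>Obj C. \<forall>b\<in>Obj C. \<forall>f\<in>Hom C a b. on_arr F f \<in> Hom D (on_obj F a) (on_obj F b)) \<and>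
    (\<forall>a\<in>Obj C. on_arr F (Id C a) = Id D (on_obj F a)) \<and>
    (\<forall>f\<in>Arr C. \<forall>g\<in>Arr C. Cod C f = Dom C g \<longrightarrow>
      on_arr F (Comp C g f) = Comp D (on_arr F g) (on_arr F f))"

lemma is_functorD:
  assumes "is_functor C D F"
  shows "a \<in> Obj C \<Longrightarrow> on_obj F a \<in> Obj D"
    "a \<in> Obj C \<Longrightarrow> b \<in> Obj C \<Longrightarrow> f \<in> Hom C a b \<Longrightarrow>
      on_arr F f \<in> Hom D (on_obj F a) (on_obj F b)"
    "a \<in> Obj C \<Longrightarrow> on_arr F (Id C a) = Id D (on_obj F a)"
    "f \<in> Arr C \<Longrightarrow> g \<in> Arr C \<Longrightarrow> Cod C f = Dom C g \<Longrightarrow>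
      on_arr F (Comp C g f) = Comp D (on_arr F g) (on_arr F f)"
  using assms by (simp_all add: is_functor_def)

definition ftor_comp ::
  "('p, 'n, 'q, 'l) ftor \<Rightarrow> ('o, 'm, 'p, 'n) ftor \<Rightarrow> ('o, 'm, 'q, 'l) ftor"
  (infixl "\<circ>\<^sub>F" 55) where
  "G \<circ>\<^sub>F F = \<lparr>on_obj = on_obj G \<circ> on_obj F, on_arr = on_arr G \<circ> on_arr F\<rparr>"

text \<open>The poset \<open>(\<real>, \<le>)\<close>: the unique arrow \<open>s \<rightarrow> t\<close>, for \<open>s \<le> t\<close>, is the pair \<open>(s, t)\<close>.\<close>

definition real_poset :: "(real, real \<times> real) category" where
  "real_poset = \<lparr>Obj = UNIV, Arr = {(s, t). s \<le> t}, Dom = fst, Cod = snd,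
    Id = (\<lambda>t. (t, t)), Comp = (\<lambda>g f. (fst f, snd g))\<rparr>"

lemma category_real_poset: "category real_poset"
  by unfold_locales (auto simp: real_poset_def Hom_def)

section \<open>Closure spaces\<close>

record 'a cspace =
  pts :: "'a set"
  cl :: "'a set \<Rightarrow> 'a set"

text \<open>The closure is a function on subsets of the point set only; using the extensional
  function space makes equality of closure spaces the mathematical one.\<close>

definition closure_space :: "'a cspace \<Rightarrow> bool" where
  "closure_space S \<longleftrightarrow>
    cl S \<in> Pow (pts S) \<rightarrow>\<^sub>E Pow (pts S) \<and>
    cl S {} = {} \<and>
    (\<forall>A. A \<subseteq> pts S \<longrightarrow> A \<subseteq> cl S A) \<and>
    (\<forall>A B. A \<subseteq> pts S \<longrightarrow> B \<subseteq> pts S \<longrightarrow> cl S (A \<union> B) = cl S A \<union> cl S B)"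

definition cts :: "'a cspace \<Rightarrow> 'b cspace \<Rightarrow> ('a \<Rightarrow> 'b) \<Rightarrow> bool" where
  "cts S T f \<longleftrightarrow> f \<in> pts S \<rightarrow> pts T \<and> (\<forall>A. A \<subseteq> pts S \<longrightarrow> f ` cl S A \<subseteq> cl T (f ` A))"

definition nbhd :: "'a cspace \<Rightarrow> 'a \<Rightarrow> 'a set \<Rightarrow> bool" where
  "nbhd S x U \<longleftrightarrow> x \<in> pts S \<and> U \<subseteq> pts S \<and> x \<notin> cl S (pts S - U)"

definition prod_cspace :: "'a cspace \<Rightarrow> 'b cspace \<Rightarrow> ('a \<times> 'b) cspace" where
  "prod_cspace S T = \<lparr>pts = pts S \<times> pts T,
    cl = (\<lambda>A \<in> Pow (pts S \<times> pts T). {(x, y) \<in> pts S \<times> pts T.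
      \<forall>U V. nbhd S x U \<longrightarrow> nbhd T y V \<longrightarrow> (U \<times> V) \<inter> A \<noteq> {}})\<rparr>"

definition J_top :: "nat cspace" where
  "J_top = \<lparr>pts = {0, 1}, cl = (\<lambda>A \<in> Pow {0, 1}. if A = {} then {} else {0, 1})\<rparr>"

lemma ctsD:
  assumes "cts S T f"
  shows "x \<in> pts S \<Longrightarrow> f x \<in> pts T" "A \<subseteq> pts S \<Longrightarrow> f ` cl S A \<subseteq> cl T (f ` A)"
  using assms unfolding cts_def by (auto simp del: image_subset_iff)

lemma closure_spaceI:
  assumes "\<And>A. A \<subseteq> pts S \<Longrightarrow> cl S A \<subseteq> pts S" "cl S \<in> extensional (Pow (pts S))" "cl S {} = {}"
    "\<And>A. A \<subseteq> pts S \<Longrightarrow> A \<subseteq> cl S A"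
    "\<And>A B. A \<subseteq> pts S \<Longrightarrow> B \<subseteq> pts S \<Longrightarrow> cl S (A \<union> B) = cl S A \<union> cl S B"
  shows "closure_space S"
  using assms unfolding closure_space_def by (auto simp: PiE_iff)

lemma closure_spaceD:
  assumes "closure_space S"
  shows "A \<subseteq> pts S \<Longrightarrow> cl S A \<subseteq> pts S" "cl S \<in> extensional (Pow (pts S))" "cl S {} = {}"
    "A \<subseteq> pts S \<Longrightarrow> A \<subseteq> cl S A"
    "A \<subseteq> pts S \<Longrightarrow> B \<subseteq> pts S \<Longrightarrow> cl S (A \<union> B) = cl S A \<union> cl S B"
proof -
  have *: "cl S \<in> Pow (pts S) \<rightarrow>\<^sub>E Pow (pts S)" "cl S {} = {}"
    "\<And>A. A \<subseteq> pts S \<Longrightarrow> A \<subseteq> cl S A"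
    "\<And>A B. A \<subseteq> pts S \<Longrightarrow> B \<subseteq> pts S \<Longrightarrow> cl S (A \<union> B) = cl S A \<union> cl S B"
    using assms by (simp_all add: closure_space_def)
  show "cl S A \<subseteq> pts S" if "A \<subseteq> pts S"
    using PiE_mem[OF *(1), of A] that by simp
  show "cl S \<in> extensional (Pow (pts S))" using *(1) by (simp add: PiE_iff)
  show "cl S {} = {}" by (rule *(2))
  show "A \<subseteq> cl S A" if "A \<subseteq> pts S" by (rule *(3)[OF that])
  show "cl S (A \<union> B) = cl S A \<union> cl S B" if "A \<subseteq> pts S" "B \<subseteq> pts S"
    by (rule *(4)[OF that])
qed

lemma cl_mono:
  assumes "closure_space S" "A \<subseteq> B" "B \<subseteq> pts S"
  shows "cl S A \<subseteq> cl S B"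
proof -
  have "cl S B = cl S A \<union> cl S B"
    using closure_spaceD(5)[OF assms(1), of A B] assms(2,3) by (simp add: Un_absorb1)
  then show ?thesis by blast
qed

lemma nbhd_Int:
  assumes S: "closure_space S" and U: "nbhd S x U" and V: "nbhd S x V"
  shows "nbhd S x (U \<inter> V)"
proof -
  have "cl S (pts S - (U \<inter> V)) = cl S (pts S - U) \<union> cl S (pts S - V)"
    using closure_spaceD(5)[OF S, of "pts S - U" "pts S - V"] by (simp add: Diff_Int)
  then show ?thesis using U V unfolding nbhd_def by auto
qed

lemma closure_space_J_top: "closure_space J_top"
  by (rule closure_spaceI) (auto simp: J_top_def)

lemma closure_space_prod:
  assumes S: "closure_space S" and T: "closure_space T"
  shows "closure_space (prod_cspace S T)"
proof (rule closure_spaceI)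
  show "cl (prod_cspace S T) {} = {}"
  proof -
    have "nbhd S x (pts S)" if "x \<in> pts S" for x
      using that closure_spaceD(3)[OF S] by (simp add: nbhd_def)
    moreover have "nbhd T x (pts T)" if "x \<in> pts T" for x
      using that closure_spaceD(3)[OF T] by (simp add: nbhd_def)
    ultimately show ?thesis unfolding prod_cspace_def by auto
  qed
next
  fix A assume A: "A \<subseteq> pts (prod_cspace S T)"
  have *: "x \<in> U" if "nbhd S x U" for x U
    using that closure_spaceD(4)[OF S, of "pts S - U"] by (auto simp: nbhd_def)
  have **: "x \<in> U" if "nbhd T x U" for x U
    using that closure_spaceD(4)[OF T, of "pts T - U"] by (auto simp: nbhd_def)
  show "A \<subseteq> cl (prod_cspace S T) A"
    using A * ** by (fastforce simp: prod_cspace_def)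
next
  fix A B assume A: "A \<subseteq> pts (prod_cspace S T)" and B: "B \<subseteq> pts (prod_cspace S T)"
  let ?P = "\<lambda>x y A. \<forall>U V. nbhd S x U \<longrightarrow> nbhd T y V \<longrightarrow> (U \<times> V) \<inter> A \<noteq> {}"
  have "?P x y (A \<union> B) \<longleftrightarrow> ?P x y A \<or> ?P x y B" for x y
  proof
    assume L: "?P x y (A \<union> B)"
    show "?P x y A \<or> ?P x y B"
    proof (rule ccontr)
      assume "\<not> (?P x y A \<or> ?P x y B)"
      then obtain U V U' V' where *: "nbhd S x U" "nbhd T y V" "(U \<times> V) \<inter> A = {}"
        "nbhd S x U'" "nbhd T y V'" "(U' \<times> V') \<inter> B = {}" by blast
      have "nbhd S x (U \<inter> U')" "nbhd T y (V \<inter> V')"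
        using * nbhd_Int[OF S] nbhd_Int[OF T] by blast+
      with L have "((U \<inter> U') \<times> (V \<inter> V')) \<inter> (A \<union> B) \<noteq> {}" by blast
      with * show False by blast
    qed
  qed blast
  then show "cl (prod_cspace S T) (A \<union> B) = cl (prod_cspace S T) A \<union> cl (prod_cspace S T) B"
    using A B by (auto simp: prod_cspace_def)
qed (auto simp: prod_cspace_def)

section \<open>The category of closure spaces and homotopy invariance\<close>

record 'a cmap =
  src :: "'a cspace"
  tgt :: "'a cspace"
  app :: "'a \<Rightarrow> 'a"

text \<open>Objects are the closure spaces whose points lie in the type \<open>'a\<close>; this type is
  arbitrary and plays the role of the universe of sets.\<close>

definition Cl :: "('a cspace, 'a cmap) category" where
  "Cl = \<lparr>Obj = {S. closure_space S},
    Arr = {f. closure_space (src f) \<and> closure_space (tgt f) \<and>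
      cts (src f) (tgt f) (app f) \<and> app f \<in> extensional (pts (src f))},
    Dom = src, Cod = tgt,
    Id = (\<lambda>S. \<lparr>src = S, tgt = S, app = (\<lambda>x \<in> pts S. x)\<rparr>),
    Comp = (\<lambda>g f. \<lparr>src = src f, tgt = tgt g, app = compose (pts (src f)) (app g) (app f)\<rparr>)\<rparr>"

definition one_step_homotopic :: "'a cmap \<Rightarrow> 'a cmap \<Rightarrow> bool" where
  "one_step_homotopic f g \<longleftrightarrow> f \<in> Arr Cl \<and> g \<in> Arr Cl \<and> src f = src g \<and> tgt f = tgt g \<and>
    (\<exists>H. cts (prod_cspace (src f) J_top) (tgt f) H \<and>
      (\<forall>x \<in> pts (src f). H (x, 0) = app f x \<and> H (x, 1) = app g x))"

definition homotopic :: "'a cmap \<Rightarrow> 'a cmap \<Rightarrow> bool" where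
  "homotopic = equivclp one_step_homotopic"

definition homotopy_invariant :: "('a cspace, 'a cmap, 'o, 'm) ftor \<Rightarrow> bool" where
  "homotopy_invariant H \<longleftrightarrow>
    (\<forall>f\<in>Arr Cl. \<forall>g\<in>Arr Cl. homotopic f g \<longrightarrow> on_arr H f = on_arr H g)"

lemma Hom_Cl_iff: "f \<in> Hom Cl a b \<longleftrightarrow> closure_space a \<and> closure_space b \<and> src f = a \<and> tgt f = b \<and>
    cts a b (app f) \<and> app f \<in> extensional (pts a)"
  by (auto simp: Hom_def Cl_def)

lemma category_Cl: "category Cl"
proof
  fix f g :: "'a cmap" and a b c
  assume f: "f \<in> Hom Cl a b" and g: "g \<in> Hom Cl b c"
  have "cts a c (compose (pts a) (app g) (app f))"
    unfolding cts_def
  proof (intro conjI allI impI)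
    show "compose (pts a) (app g) (app f) \<in> pts a \<rightarrow> pts c"
      using f g ctsD(1)[of a b "app f"] ctsD(1)[of b c "app g"] by (auto simp: Hom_Cl_iff compose_def)
    fix A assume A: "A \<subseteq> pts a"
    have "cl a A \<subseteq> pts a"
      using A f closure_spaceD(1)[of a A] by (auto simp: Hom_def Cl_def)
    then have "compose (pts a) (app g) (app f) ` cl a A = app g ` (app f ` cl a A)"
      by (force simp: compose_def)
    also have "\<dots> \<subseteq> app g ` cl b (app f ` A)"
      by (intro image_mono ctsD(2)) (use A f in \<open>simp_all add: Hom_Cl_iff\<close>)
    also have "\<dots> \<subseteq> cl c (app g ` (app f ` A))"
    proof -
      have "app f ` A \<subseteq> pts b" using A f ctsD(1)[of a b "app f"] by (auto simp: Hom_Cl_iff)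
      then show ?thesis by (rule ctsD(2)[rotated]) (use g in \<open>simp add: Hom_Cl_iff\<close>)
    qed
    also have "app g ` (app f ` A) = compose (pts a) (app g) (app f) ` A"
      using A by (force simp: compose_def)
    finally show "compose (pts a) (app g) (app f) ` cl a A
      \<subseteq> cl c (compose (pts a) (app g) (app f) ` A)" .
  qed
  then show "Comp Cl g f \<in> Hom Cl a c"
    using f g by (auto simp: Hom_def Cl_def)
next
  fix a :: "'a cspace" assume "a \<in> Obj Cl"
  then have a: "closure_space a" by (simp add: Cl_def)
  have "(\<lambda>x\<in>pts a. x) ` A = A" if "A \<subseteq> pts a" for A using that by force
  then have "cts a a (\<lambda>x \<in> pts a. x)"
    using closure_spaceD(1)[OF a] by (auto simp: cts_def)
  then show "Id Cl a \<in> Hom Cl a a" using a by (simp add: Hom_def Cl_def)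
next
  fix f :: "'a cmap" and a b assume f: "f \<in> Hom Cl a b"
  show "Comp Cl f (Id Cl a) = f" "Comp Cl (Id Cl b) f = f"
    using f by (auto simp: Hom_def Cl_def cts_def compose_def extensional_def fun_eq_iff
        intro!: cmap.equality)
next
  fix f g h :: "'a cmap" and a b c d
  assume "f \<in> Hom Cl a b" "g \<in> Hom Cl b c" "h \<in> Hom Cl c d"
  then show "Comp Cl h (Comp Cl g f) = Comp Cl (Comp Cl h g) f"
    by (auto simp: Hom_def Cl_def cts_def compose_def fun_eq_iff)
qed (auto simp: Cl_def)

lemma monomorphism_Cl_iff: "monomorphism Cl f \<longleftrightarrow> f \<in> Arr Cl \<and> inj_on (app f) (pts (src f))"
proof (intro iffI conjI)
  assume m: "monomorphism Cl f"
  then show f: "f \<in> Arr Cl" by (simp add: monomorphism_def)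
  show "inj_on (app f) (pts (src f))"
  proof (rule inj_onI)
    fix x y assume x: "x \<in> pts (src f)" and y: "y \<in> pts (src f)" and e: "app f x = app f y"
    define P :: "'a cspace" where "P = \<lparr>pts = {x}, cl = (\<lambda>A \<in> Pow {x}. A)\<rparr>"
    define k where "k z = \<lparr>src = P, tgt = src f, app = (\<lambda>w \<in> {x}. z)\<rparr>" for z
    have P: "closure_space P" by (rule closure_spaceI) (auto simp: P_def)
    have k: "k z \<in> Arr Cl" if "z \<in> pts (src f)" for z
    proof -
      have S: "closure_space (src f)" using f by (simp add: Cl_def)
      have "cts P (src f) (\<lambda>w \<in> {x}. z)"
        unfolding cts_def
      proof (intro conjI allI impI)
        show "(\<lambda>w \<in> {x}. z) \<in> pts P \<rightarrow> pts (src f)" using that by (simp add: P_def)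
        fix A assume "A \<subseteq> pts P"
        then have A: "A \<subseteq> {x}" by (simp add: P_def)
        then have "(\<lambda>w \<in> {x}. z) ` A \<subseteq> pts (src f)" using that by auto
        from closure_spaceD(4)[OF S this] A
        show "(\<lambda>w \<in> {x}. z) ` cl P A \<subseteq> cl (src f) ((\<lambda>w \<in> {x}. z) ` A)"
          by (simp add: P_def del: image_subset_iff)
      qed
      then show ?thesis using P S by (simp add: Cl_def k_def P_def)
    qed
    have "Comp Cl f (k x) = Comp Cl f (k y)"
      using e by (auto simp: Cl_def k_def P_def compose_def fun_eq_iff)
    moreover have "Cod Cl (k z) = Dom Cl f \<and> Dom Cl (k z) = P" for z
      by (simp add: Cl_def k_def)
    ultimately have "k x = k y"
      using m k[OF x] k[OF y] unfolding monomorphism_def by metis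
    then have "app (k x) x = app (k y) x" by simp
    then show "x = y" by (simp add: k_def)
  qed
next
  assume f: "f \<in> Arr Cl \<and> inj_on (app f) (pts (src f))"
  show "monomorphism Cl f" unfolding monomorphism_def
  proof (intro conjI ballI impI)
    show "f \<in> Arr Cl" using f by simp
    fix g h :: "'a cmap" assume g: "g \<in> Arr Cl" and h: "h \<in> Arr Cl"
      and e: "Cod Cl g = Dom Cl f \<and> Cod Cl h = Dom Cl f \<and> Dom Cl g = Dom Cl h \<and>
        Comp Cl f g = Comp Cl f h"
    have "app g x = app h x" for x
    proof (cases "x \<in> pts (src g)")
      case True
      have "src g = src h" using e by (simp add: Cl_def)
      moreover have "app (Comp Cl f g) x = app (Comp Cl f h) x" using e by simp
      ultimately have "app f (app g x) = app f (app h x)"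
        using True by (simp add: Cl_def compose_def)
      moreover have "app g x \<in> pts (src f)" "app h x \<in> pts (src f)"
        using True e ctsD(1)[of "src g" "tgt g" "app g" x] ctsD(1)[of "src h" "tgt h" "app h" x] g h
        by (simp_all add: Cl_def)
      ultimately show ?thesis using f by (meson inj_onD)
    next
      case False
      then show ?thesis using g h e by (auto simp: Cl_def extensional_def)
    qed
    then show "g = h" using e by (auto simp: Cl_def fun_eq_iff intro: cmap.equality)
  qed
qed

section \<open>Filtrations\<close>

type_synonym 'a cfiltration = "(real, real \<times> real, 'a cspace, 'a cmap) ftor"

abbreviation at_time :: "'a cfiltration \<Rightarrow> real \<Rightarrow> 'a cspace" where
  "at_time X t \<equiv> on_obj X t"

abbreviation trans_map :: "'a cfiltration \<Rightarrow> real \<Rightarrow> real \<Rightarrow> 'a \<Rightarrow> 'a" where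
  "trans_map X s t \<equiv> app (on_arr X (s, t))"

definition filtration :: "'a cfiltration \<Rightarrow> bool" where
  "filtration X \<longleftrightarrow> is_functor real_poset Cl X \<and>
    (\<forall>s t. s \<le> t \<longrightarrow> monomorphism Cl (on_arr X (s, t)))"

definition filtered_cspace :: "'a cfiltration \<Rightarrow> bool" where
  "filtered_cspace X \<longleftrightarrow> filtration X \<and>
    (\<forall>s t. s \<le> t \<longrightarrow> pts (at_time X s) \<subseteq> pts (at_time X t) \<and>
      (\<forall>x \<in> pts (at_time X s). trans_map X s t x = x))"

definition total_set :: "'a cfiltration \<Rightarrow> 'a set" where
  "total_set X = (\<Union>t. pts (at_time X t))"

lemma filtration_trans_map:
  assumes X: "filtration X" and st: "s \<le> t"
  shows "closure_space (at_time X s)" "cts (at_time X s) (at_time X t) (trans_map X s t)"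
    "inj_on (trans_map X s t) (pts (at_time X s))"
    "trans_map X s t \<in> extensional (pts (at_time X s))"
    "src (on_arr X (s, t)) = at_time X s" "tgt (on_arr X (s, t)) = at_time X t"
proof -
  have "on_arr X (s, t) \<in> Hom Cl (at_time X s) (at_time X t)"
    by (rule is_functorD(2)[where C = real_poset])
      (use X st in \<open>simp_all add: filtration_def real_poset_def Hom_def\<close>)
  moreover have "monomorphism Cl (on_arr X (s, t))"
    using X st unfolding filtration_def by blast
  ultimately show "closure_space (at_time X s)"
    "cts (at_time X s) (at_time X t) (trans_map X s t)"
    "inj_on (trans_map X s t) (pts (at_time X s))"
    "trans_map X s t \<in> extensional (pts (at_time X s))"
    "src (on_arr X (s, t)) = at_time X s" "tgt (on_arr X (s, t)) = at_time X t"
    by (simp_all add: Hom_Cl_iff monomorphism_Cl_iff)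
qed

lemma filtration_trans_map_id:
  assumes X: "filtration X" and x: "x \<in> pts (at_time X t)"
  shows "trans_map X t t x = x"
proof -
  have "on_arr X (t, t) = Id Cl (at_time X t)"
    using is_functorD(3)[of real_poset Cl X t] X by (simp add: filtration_def real_poset_def)
  then show ?thesis using x by (simp add: Cl_def)
qed

lemma filtration_trans_map_comp:
  assumes X: "filtration X" and st: "s \<le> t" and tu: "t \<le> u" and x: "x \<in> pts (at_time X s)"
  shows "trans_map X t u (trans_map X s t x) = trans_map X s u x"
proof -
  have "on_arr X (s, u) = Comp Cl (on_arr X (t, u)) (on_arr X (s, t))"
    using is_functorD(4)[of real_poset Cl X "(s, t)" "(t, u)"] X st tu
    by (simp add: filtration_def real_poset_def)
  then show ?thesis
    using x filtration_trans_map(5)[OF X st] by (simp add: Cl_def compose_def)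
qed

subsection \<open>The colimit of a filtration\<close>

text \<open>The colimit is the set of equivalence classes of pairs \<open>(s, y)\<close> with \<open>y \<in> X\<^sub>s\<close>, two
  pairs being identified if they agree at a later time; \<open>colim_in X t\<close> is the leg from
  \<open>X\<^sub>t\<close>, and the closure is the final one (coproduct followed by quotient).\<close>

definition colim_in :: "'a cfiltration \<Rightarrow> real \<Rightarrow> 'a \<Rightarrow> (real \<times> 'a) set" where
  "colim_in X t x = {(s, y). y \<in> pts (at_time X s) \<and>
    (\<exists>u. s \<le> u \<and> t \<le> u \<and> trans_map X s u y = trans_map X t u x)}"

definition colim_cspace :: "'a cfiltration \<Rightarrow> (real \<times> 'a) set cspace" where
  "colim_cspace X = \<lparr>pts = (\<Union>t. colim_in X t ` pts (at_time X t)),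
    cl = (\<lambda>A \<in> Pow (\<Union>t. colim_in X t ` pts (at_time X t)).
      \<Union>t. colim_in X t ` cl (at_time X t) {x \<in> pts (at_time X t). colim_in X t x \<in> A})\<rparr>"

text \<open>The \<open>\<real>\<close>-filtered closure space of the images of the \<open>X\<^sub>t\<close> in the colimit.\<close>

definition colim_image :: "'a cfiltration \<Rightarrow> real \<Rightarrow> (real \<times> 'a) set cspace" where
  "colim_image X t = \<lparr>pts = colim_in X t ` pts (at_time X t),
    cl = (\<lambda>A \<in> Pow (colim_in X t ` pts (at_time X t)).
      colim_in X t ` cl (at_time X t) {x \<in> pts (at_time X t). colim_in X t x \<in> A})\<rparr>"

definition filtered_of :: "'a cfiltration \<Rightarrow> (real \<times> 'a) set cfiltration" where
  "filtered_of X = \<lparr>on_obj = colim_image X,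
    on_arr = (\<lambda>(s, t). \<lparr>src = colim_image X s, tgt = colim_image X t,
      app = (\<lambda>x \<in> pts (colim_image X s). x)\<rparr>)\<rparr>"

lemma colim_in_eq_iff:
  assumes X: "filtration X" and su: "s \<le> u" and tu: "t \<le> u"
    and x: "x \<in> pts (at_time X s)" and y: "y \<in> pts (at_time X t)"
  shows "colim_in X s x = colim_in X t y \<longleftrightarrow> trans_map X s u x = trans_map X t u y"
proof -
  have key: "trans_map X p v z = trans_map X q v w"
    if "p \<le> u'" "q \<le> u'" "p \<le> v" "q \<le> v" "z \<in> pts (at_time X p)" "w \<in> pts (at_time X q)"
      "trans_map X p u' z = trans_map X q u' w" for p q u' v z w
  proof -
    let ?m = "max u' v"
    have "trans_map X v ?m (trans_map X p v z) = trans_map X p ?m z"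
      using filtration_trans_map_comp[OF X, of p v ?m z] that by simp
    also have "\<dots> = trans_map X u' ?m (trans_map X p u' z)"
      using filtration_trans_map_comp[OF X, of p u' ?m z] that by simp
    also have "\<dots> = trans_map X u' ?m (trans_map X q u' w)" using that by simp
    also have "\<dots> = trans_map X q ?m w"
      using filtration_trans_map_comp[OF X, of q u' ?m w] that by simp
    also have "\<dots> = trans_map X v ?m (trans_map X q v w)"
      using filtration_trans_map_comp[OF X, of q v ?m w] that by simp
    finally have e: "trans_map X v ?m (trans_map X p v z) = trans_map X v ?m (trans_map X q v w)" .
    have "trans_map X p v z \<in> pts (at_time X v)" "trans_map X q v w \<in> pts (at_time X v)"
      using filtration_trans_map(2)[OF X \<open>p \<le> v\<close>] filtration_trans_map(2)[OF X \<open>q \<le> v\<close>] that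
      by (auto simp: cts_def)
    with e show ?thesis
      using filtration_trans_map(3)[OF X, of v ?m] by (simp add: inj_on_def)
  qed
  show ?thesis
  proof
    assume "colim_in X s x = colim_in X t y"
    moreover have "(s, x) \<in> colim_in X s x" using x by (auto simp: colim_in_def)
    ultimately have "(s, x) \<in> colim_in X t y" by simp
    then show "trans_map X s u x = trans_map X t u y"
      using key[of s _ t u x y] su tu x y by (auto simp: colim_in_def)
  next
    assume e: "trans_map X s u x = trans_map X t u y"
    have "(r, z) \<in> colim_in X s x \<longleftrightarrow> (r, z) \<in> colim_in X t y" for r z
    proof -
      let ?m = "max r u"
      have e': "trans_map X s ?m x = trans_map X t ?m y"
        by (rule key[OF su tu _ _ x y e]) (use su tu in auto)
      have "(r, z) \<in> colim_in X s x \<longleftrightarrow>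
          z \<in> pts (at_time X r) \<and> trans_map X r ?m z = trans_map X s ?m x"
      proof
        show "z \<in> pts (at_time X r) \<and> trans_map X r ?m z = trans_map X s ?m x"
          if "(r, z) \<in> colim_in X s x"
          using that key[of r _ s ?m z x] su x by (auto simp: colim_in_def)
        show "(r, z) \<in> colim_in X s x"
          if "z \<in> pts (at_time X r) \<and> trans_map X r ?m z = trans_map X s ?m x"
          using that su unfolding colim_in_def by (auto intro!: exI[of _ ?m])
      qed
      also have "\<dots> \<longleftrightarrow> z \<in> pts (at_time X r) \<and> trans_map X r ?m z = trans_map X t ?m y"
        using e' by simp
      also have "\<dots> \<longleftrightarrow> (r, z) \<in> colim_in X t y"
      proof
        show "z \<in> pts (at_time X r) \<and> trans_map X r ?m z = trans_map X t ?m y"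
          if "(r, z) \<in> colim_in X t y"
          using that key[of r _ t ?m z y] tu y by (auto simp: colim_in_def)
        show "(r, z) \<in> colim_in X t y"
          if "z \<in> pts (at_time X r) \<and> trans_map X r ?m z = trans_map X t ?m y"
          using that tu unfolding colim_in_def by (auto intro!: exI[of _ ?m])
      qed
      finally show ?thesis .
    qed
    then show "colim_in X s x = colim_in X t y" by auto
  qed
qed

lemma colim_in_inj:
  assumes X: "filtration X" shows "inj_on (colim_in X t) (pts (at_time X t))"
  by (rule inj_onI) (use colim_in_eq_iff[OF X, of t t t] filtration_trans_map_id[OF X] in auto)

lemma colim_in_trans_map:
  assumes X: "filtration X" and st: "s \<le> t" and x: "x \<in> pts (at_time X s)"
  shows "colim_in X t (trans_map X s t x) = colim_in X s x"
proof -
  have "trans_map X s t x \<in> pts (at_time X t)"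
    using filtration_trans_map(2)[OF X st] x by (auto simp: cts_def)
  then show ?thesis
    using colim_in_eq_iff[OF X, of t t s "trans_map X s t x" x] st x
    by (simp add: filtration_trans_map_id[OF X])
qed

text \<open>The legs are continuous, and \<open>colim_cspace X\<close> has the universal property of the colimit
  (for target spaces over every type).\<close>

lemma cts_colim_in:
  assumes X: "filtration X"
  shows "cts (at_time X t) (colim_cspace X) (colim_in X t)"
  unfolding cts_def
proof (intro conjI allI impI)
  show "colim_in X t \<in> pts (at_time X t) \<rightarrow> pts (colim_cspace X)"
    by (auto simp: colim_cspace_def)
  fix A assume A: "A \<subseteq> pts (at_time X t)"
  let ?B = "{x \<in> pts (at_time X t). colim_in X t x \<in> colim_in X t ` A}"
  have "cl (at_time X t) A \<subseteq> cl (at_time X t) ?B"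
    by (rule cl_mono) (use A filtration_trans_map(1)[OF X order_refl] in auto)
  moreover have "colim_in X t ` A \<in> Pow (\<Union>t. colim_in X t ` pts (at_time X t))" using A by auto
  ultimately show "colim_in X t ` cl (at_time X t) A \<subseteq> cl (colim_cspace X) (colim_in X t ` A)"
    by (fastforce simp: colim_cspace_def)
qed

lemma closure_space_colim:
  assumes X: "filtration X"
  shows "closure_space (colim_cspace X)"
proof (rule closure_spaceI)
  have cs: "closure_space (at_time X t)" for t using filtration_trans_map(1)[OF X order_refl] .
  let ?U = "\<Union>t. colim_in X t ` pts (at_time X t)"
  let ?p = "\<lambda>t A. {x \<in> pts (at_time X t). colim_in X t x \<in> A}"
  show "cl (colim_cspace X) A \<subseteq> pts (colim_cspace X)" if "A \<subseteq> pts (colim_cspace X)" for A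
  proof -
    have "cl (at_time X t) (?p t A) \<subseteq> pts (at_time X t)" for t
      by (rule closure_spaceD(1)[OF cs]) auto
    then show ?thesis using that by (fastforce simp: colim_cspace_def)
  qed
  show "cl (colim_cspace X) {} = {}"
    using closure_spaceD(3)[OF cs] by (auto simp: colim_cspace_def)
  show "A \<subseteq> cl (colim_cspace X) A" if A: "A \<subseteq> pts (colim_cspace X)" for A
  proof
    fix z assume z: "z \<in> A"
    then obtain t x where x: "x \<in> pts (at_time X t)" "z = colim_in X t x"
      using A by (auto simp: colim_cspace_def)
    have "?p t A \<subseteq> cl (at_time X t) (?p t A)" by (rule closure_spaceD(4)[OF cs]) auto
    then have "x \<in> cl (at_time X t) (?p t A)" using x z by auto
    then show "z \<in> cl (colim_cspace X) A" using x A by (auto simp: colim_cspace_def)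
  qed
  show "cl (colim_cspace X) (A \<union> B) = cl (colim_cspace X) A \<union> cl (colim_cspace X) B"
    if A: "A \<subseteq> pts (colim_cspace X)" and B: "B \<subseteq> pts (colim_cspace X)" for A B
  proof -
    have "cl (at_time X t) (?p t (A \<union> B))
      = cl (at_time X t) (?p t A) \<union> cl (at_time X t) (?p t B)" for t
    proof -
      have "?p t (A \<union> B) = ?p t A \<union> ?p t B" by auto
      then show ?thesis using closure_spaceD(5)[OF cs, of "?p t A" t "?p t B"] by auto
    qed
    then have "(\<Union>t. colim_in X t ` cl (at_time X t) (?p t (A \<union> B)))
      = (\<Union>t. colim_in X t ` cl (at_time X t) (?p t A)) \<union>
        (\<Union>t. colim_in X t ` cl (at_time X t) (?p t B))" by auto
    then show ?thesis using A B by (simp add: colim_cspace_def)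
  qed
qed (auto simp: colim_cspace_def)

lemma colim_universal:
  fixes Z :: "'b cspace"
  assumes X: "filtration X" and Z: "closure_space Z"
    and g: "\<And>t. cts (at_time X t) Z (g t)"
    and compat: "\<And>s t x. s \<le> t \<Longrightarrow> x \<in> pts (at_time X s) \<Longrightarrow> g t (trans_map X s t x) = g s x"
  shows "\<exists>!h. cts (colim_cspace X) Z h \<and> h \<in> extensional (pts (colim_cspace X)) \<and>
    (\<forall>t. \<forall>x \<in> pts (at_time X t). h (colim_in X t x) = g t x)"
proof (rule ex_ex1I)
  define h where "h = (\<lambda>z \<in> pts (colim_cspace X).
    (SOME w. \<exists>t x. x \<in> pts (at_time X t) \<and> z = colim_in X t x \<and> w = g t x))"
  have h: "h (colim_in X t x) = g t x" if x: "x \<in> pts (at_time X t)" for t x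
  proof -
    let ?Q = "\<lambda>w. \<exists>s y. y \<in> pts (at_time X s) \<and> colim_in X t x = colim_in X s y \<and> w = g s y"
    have "?Q (g t x)" using x by blast
    then have "?Q (SOME w. ?Q w)" by (rule someI)
    then obtain s y where y: "y \<in> pts (at_time X s)" "colim_in X t x = colim_in X s y"
      and w: "(SOME w. ?Q w) = g s y" by blast
    have "trans_map X t (max s t) x = trans_map X s (max s t) y"
      using colim_in_eq_iff[OF X, of t "max s t" s x y] x y by simp
    then have "g t x = g s y"
      using compat[of t "max s t" x] compat[of s "max s t" y] x y by simp
    moreover have "colim_in X t x \<in> pts (colim_cspace X)" using x by (auto simp: colim_cspace_def)
    ultimately show ?thesis using w by (simp add: h_def)
  qed
  have "cts (colim_cspace X) Z h"
    unfolding cts_def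
  proof (intro conjI allI impI)
    show hZ: "h \<in> pts (colim_cspace X) \<rightarrow> pts Z"
    proof
      fix z assume "z \<in> pts (colim_cspace X)"
      then obtain t x where x: "x \<in> pts (at_time X t)" "z = colim_in X t x"
        by (auto simp: colim_cspace_def)
      then show "h z \<in> pts Z" using h[OF x(1)] g[of t] by (auto simp: cts_def)
    qed
    fix A assume A: "A \<subseteq> pts (colim_cspace X)"
    show "h ` cl (colim_cspace X) A \<subseteq> cl Z (h ` A)"
    proof
      fix w assume "w \<in> h ` cl (colim_cspace X) A"
      then obtain t x where x: "x \<in> cl (at_time X t) {x \<in> pts (at_time X t). colim_in X t x \<in> A}"
        and w: "w = h (colim_in X t x)" using A by (auto simp: colim_cspace_def)
      let ?B = "{x \<in> pts (at_time X t). colim_in X t x \<in> A}"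
      have "cl (at_time X t) ?B \<subseteq> pts (at_time X t)"
        by (rule closure_spaceD(1)) (use filtration_trans_map(1)[OF X order_refl] in auto)
      with x have "w = g t x" using h w by auto
      also have "\<dots> \<in> g t ` cl (at_time X t) ?B" using x by blast
      also have "g t ` cl (at_time X t) ?B \<subseteq> cl Z (g t ` ?B)"
        by (rule ctsD(2)[OF g]) blast
      also have "\<dots> \<subseteq> cl Z (h ` A)"
      proof (rule cl_mono[OF Z])
        show "g t ` ?B \<subseteq> h ` A"
        proof
          fix v assume "v \<in> g t ` ?B"
          then obtain y where "y \<in> pts (at_time X t)" "colim_in X t y \<in> A" "v = g t y" by blast
          then show "v \<in> h ` A" using h[of y t] by (metis imageI)
        qed
        show "h ` A \<subseteq> pts Z" using hZ A by auto
      qed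
      finally show "w \<in> cl Z (h ` A)" by simp
    qed
  qed
  moreover have "h \<in> extensional (pts (colim_cspace X))" by (simp add: h_def)
  ultimately show "\<exists>h. cts (colim_cspace X) Z h \<and> h \<in> extensional (pts (colim_cspace X)) \<and>
    (\<forall>t. \<forall>x \<in> pts (at_time X t). h (colim_in X t x) = g t x)"
    using h by blast
next
  fix h k
  assume h: "cts (colim_cspace X) Z h \<and> h \<in> extensional (pts (colim_cspace X)) \<and>
      (\<forall>t. \<forall>x \<in> pts (at_time X t). h (colim_in X t x) = g t x)"
    and k: "cts (colim_cspace X) Z k \<and> k \<in> extensional (pts (colim_cspace X)) \<and>
      (\<forall>t. \<forall>x \<in> pts (at_time X t). k (colim_in X t x) = g t x)"
  have "h z = k z" if "z \<in> pts (colim_cspace X)" for z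
    using that h k by (auto simp: colim_cspace_def)
  then show "h = k" using h k by (meson extensionalityI)
qed

lemma colim_image_cl:
  assumes X: "filtration X" and A: "A \<subseteq> pts (at_time X t)"
  shows "cl (colim_image X t) (colim_in X t ` A) = colim_in X t ` cl (at_time X t) A"
proof -
  have "{x \<in> pts (at_time X t). colim_in X t x \<in> colim_in X t ` A} = A"
    using A colim_in_inj[OF X, of t] by (auto simp: inj_on_def)
  then show ?thesis using A by (auto simp: colim_image_def)
qed

lemma closure_space_colim_image:
  assumes X: "filtration X"
  shows "closure_space (colim_image X t)"
proof (rule closure_spaceI)
  have cs: "closure_space (at_time X t)" using filtration_trans_map(1)[OF X order_refl] .
  have P: "pts (colim_image X t) = colim_in X t ` pts (at_time X t)" by (simp add: colim_image_def)
  show "cl (colim_image X t) \<in> extensional (Pow (pts (colim_image X t)))"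
    by (simp add: colim_image_def)
  show "cl (colim_image X t) {} = {}"
    using colim_image_cl[OF X, of "{}" t] closure_spaceD(3)[OF cs] by simp
  show "cl (colim_image X t) A \<subseteq> pts (colim_image X t)"
    "A \<subseteq> cl (colim_image X t) A" if "A \<subseteq> pts (colim_image X t)" for A
  proof -
    obtain A' where A': "A' \<subseteq> pts (at_time X t)" "A = colim_in X t ` A'"
      using \<open>A \<subseteq> pts (colim_image X t)\<close> unfolding P by (rule subset_imageE)
    have e: "cl (colim_image X t) A = colim_in X t ` cl (at_time X t) A'"
      using colim_image_cl[OF X A'(1)] A'(2) by simp
    show "cl (colim_image X t) A \<subseteq> pts (colim_image X t)"
      unfolding e P by (rule image_mono[OF closure_spaceD(1)[OF cs A'(1)]])
    show "A \<subseteq> cl (colim_image X t) A"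
      unfolding e unfolding A'(2) by (rule image_mono[OF closure_spaceD(4)[OF cs A'(1)]])
  qed
  show "cl (colim_image X t) (A \<union> B) = cl (colim_image X t) A \<union> cl (colim_image X t) B"
    if A: "A \<subseteq> pts (colim_image X t)" and B: "B \<subseteq> pts (colim_image X t)" for A B
  proof -
    obtain A' where A': "A' \<subseteq> pts (at_time X t)" "A = colim_in X t ` A'"
      using A unfolding P by (rule subset_imageE)
    obtain B' where B': "B' \<subseteq> pts (at_time X t)" "B = colim_in X t ` B'"
      using B unfolding P by (rule subset_imageE)
    have "A \<union> B = colim_in X t ` (A' \<union> B')" using A'(2) B'(2) by (simp add: image_Un)
    then have "cl (colim_image X t) (A \<union> B) = colim_in X t ` cl (at_time X t) (A' \<union> B')"
      using colim_image_cl[OF X, of "A' \<union> B'" t] A'(1) B'(1) by simp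
    also have "\<dots> = cl (colim_image X t) A \<union> cl (colim_image X t) B"
      using closure_spaceD(5)[OF cs A'(1) B'(1)] colim_image_cl[OF X A'(1)]
        colim_image_cl[OF X B'(1)] A'(2) B'(2) by (simp add: image_Un)
    finally show ?thesis .
  qed
qed

lemma filtered_cspace_filtered_of:
  assumes X: "filtration X"
  shows "filtered_cspace (filtered_of X)"
proof -
  have sub: "pts (colim_image X s) \<subseteq> pts (colim_image X t)" if "s \<le> t" for s t
  proof
    fix z assume "z \<in> pts (colim_image X s)"
    then obtain x where x: "x \<in> pts (at_time X s)" "z = colim_in X s x"
      by (auto simp: colim_image_def)
    then have "z = colim_in X t (trans_map X s t x)" using colim_in_trans_map[OF X that] by simp
    moreover have "trans_map X s t x \<in> pts (at_time X t)"
      using x ctsD(1)[OF filtration_trans_map(2)[OF X that]] by simp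
    ultimately show "z \<in> pts (colim_image X t)" by (auto simp: colim_image_def)
  qed
  have clsub: "cl (colim_image X s) A \<subseteq> cl (colim_image X t) A"
    if st: "s \<le> t" and A: "A \<subseteq> pts (colim_image X s)" for s t A
  proof -
    have "A \<subseteq> colim_in X s ` pts (at_time X s)" using A by (simp add: colim_image_def)
    then obtain A' where A': "A' \<subseteq> pts (at_time X s)" "A = colim_in X s ` A'"
      by (rule subset_imageE)
    let ?T = "trans_map X s t"
    have T: "?T ` A' \<subseteq> pts (at_time X t)"
      using A'(1) ctsD(1)[OF filtration_trans_map(2)[OF X st]] by blast
    have cA: "cl (at_time X s) A' \<subseteq> pts (at_time X s)"
      using closure_spaceD(1)[OF filtration_trans_map(1)[OF X st] A'(1)] .
    have "cl (colim_image X s) A = colim_in X s ` cl (at_time X s) A'"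
      using colim_image_cl[OF X A'(1)] A' by simp
    also have "\<dots> = colim_in X t ` ?T ` cl (at_time X s) A'"
      unfolding image_image using cA by (intro image_cong) (auto simp: colim_in_trans_map[OF X st])
    also have "\<dots> \<subseteq> colim_in X t ` cl (at_time X t) (?T ` A')"
      by (intro image_mono ctsD(2)[OF filtration_trans_map(2)[OF X st] A'(1)])
    also have "\<dots> = cl (colim_image X t) (colim_in X t ` ?T ` A')"
      using colim_image_cl[OF X T] by simp
    also have "colim_in X t ` ?T ` A' = A"
      unfolding image_image A'(2) using A'(1)
      by (intro image_cong) (auto simp: colim_in_trans_map[OF X st])
    finally show ?thesis .
  qed
  have arr: "on_arr (filtered_of X) (s, t) \<in> Hom Cl (colim_image X s) (colim_image X t)"
    if st: "s \<le> t" for s t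
  proof -
    have "cts (colim_image X s) (colim_image X t) (\<lambda>x \<in> pts (colim_image X s). x)"
      unfolding cts_def
    proof (intro conjI allI impI)
      show "(\<lambda>x \<in> pts (colim_image X s). x) \<in> pts (colim_image X s) \<rightarrow> pts (colim_image X t)"
        using sub[OF st] by auto
      fix A assume A: "A \<subseteq> pts (colim_image X s)"
      have *: "(\<lambda>x \<in> pts (colim_image X s). x) ` B = B" if "B \<subseteq> pts (colim_image X s)" for B
        using that by force
      show "(\<lambda>x \<in> pts (colim_image X s). x) ` cl (colim_image X s) A
        \<subseteq> cl (colim_image X t) ((\<lambda>x \<in> pts (colim_image X s). x) ` A)"
        using clsub[OF st A] *[OF A]
          *[OF closure_spaceD(1)[OF closure_space_colim_image[OF X] A]] by simp
    qed
    then show ?thesis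
      using closure_space_colim_image[OF X] by (simp add: Hom_def Cl_def filtered_of_def)
  qed
  have "is_functor real_poset Cl (filtered_of X)"
    unfolding is_functor_def
  proof (intro conjI ballI impI)
    fix a :: real
    show "on_obj (filtered_of X) a \<in> Obj Cl"
      using closure_space_colim_image[OF X] by (simp add: Cl_def filtered_of_def)
    show "on_arr (filtered_of X) (Id real_poset a) = Id Cl (on_obj (filtered_of X) a)"
      by (simp add: Cl_def filtered_of_def real_poset_def)
  next
    fix a b :: real and f assume "f \<in> Hom real_poset a b"
    then show "on_arr (filtered_of X) f \<in> Hom Cl (on_obj (filtered_of X) a) (on_obj (filtered_of X) b)"
      using arr by (auto simp: Hom_def real_poset_def filtered_of_def)
  next
    fix f g assume "f \<in> Arr real_poset" "g \<in> Arr real_poset" "Cod real_poset f = Dom real_poset g"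
    then show "on_arr (filtered_of X) (Comp real_poset g f)
      = Comp Cl (on_arr (filtered_of X) g) (on_arr (filtered_of X) f)"
      using sub[THEN subsetD]
      by (auto simp: real_poset_def filtered_of_def Cl_def compose_def intro!: restrict_ext)
  qed
  moreover have "monomorphism Cl (on_arr (filtered_of X) (s, t))" if "s \<le> t" for s t
    using arr[OF that] by (auto simp: monomorphism_Cl_iff Hom_def filtered_of_def inj_on_def)
  ultimately show ?thesis
    using sub by (auto simp: filtered_cspace_def filtration_def filtered_of_def)
qed

section \<open>Correspondences and the Gromov--Hausdorff distance\<close>

definition multivalued_map :: "'a set \<Rightarrow> 'b set \<Rightarrow> ('a \<times> 'b) set \<Rightarrow> bool" where
  "multivalued_map S T C \<longleftrightarrow> C \<subseteq> S \<times> T \<and> fst ` C = S"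

definition correspondence :: "'a set \<Rightarrow> 'b set \<Rightarrow> ('a \<times> 'b) set \<Rightarrow> bool" where
  "correspondence S T C \<longleftrightarrow> multivalued_map S T C \<and> snd ` C = T"

definition subordinate :: "'a set \<Rightarrow> ('a \<times> 'b) set \<Rightarrow> ('a \<Rightarrow> 'b) \<Rightarrow> bool" where
  "subordinate S C f \<longleftrightarrow> (\<forall>x\<in>S. (x, f x) \<in> C)"

definition eps_multivalued_map ::
  "'a cfiltration \<Rightarrow> 'b cfiltration \<Rightarrow> real \<Rightarrow> ('a \<times> 'b) set \<Rightarrow> bool" where
  "eps_multivalued_map X Y \<epsilon> C \<longleftrightarrow> multivalued_map (total_set X) (total_set Y) C \<and>
    (\<forall>t. (\<forall>x y. x \<in> pts (at_time X t) \<and> (x, y) \<in> C \<longrightarrow> y \<in> pts (at_time Y (t + \<epsilon>))) \<and>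
      (\<forall>A f. A \<subseteq> pts (at_time X t) \<longrightarrow> subordinate (total_set X) C f \<longrightarrow>
        C `` cl (at_time X t) A \<subseteq> cl (at_time Y (t + \<epsilon>)) (f ` A)))"

definition eps_correspondence ::
  "'a cfiltration \<Rightarrow> 'b cfiltration \<Rightarrow> real \<Rightarrow> ('a \<times> 'b) set \<Rightarrow> bool" where
  "eps_correspondence X Y \<epsilon> C \<longleftrightarrow> correspondence (total_set X) (total_set Y) C \<and>
    eps_multivalued_map X Y \<epsilon> C \<and> eps_multivalued_map Y X \<epsilon> (C\<inverse>)"

definition corr_dist :: "'a cfiltration \<Rightarrow> 'b cfiltration \<Rightarrow> ('a \<times> 'b) set \<Rightarrow> ennreal" where
  "corr_dist X Y C = Inf {ennreal \<epsilon> | \<epsilon>. 0 \<le> \<epsilon> \<and> eps_correspondence X Y \<epsilon> C}"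

text \<open>\<open>d\<^sub>G\<^sub>H\<close> for \<open>\<real>\<close>-filtered closure spaces and, via the colimit, for \<open>\<real>\<close>-filtrations.\<close>

definition gh_filtered :: "'a cfiltration \<Rightarrow> 'b cfiltration \<Rightarrow> ennreal" where
  "gh_filtered X Y =
    Inf {corr_dist X Y C | C. correspondence (total_set X) (total_set Y) C} / 2"

definition gh_dist :: "'a cfiltration \<Rightarrow> 'b cfiltration \<Rightarrow> ennreal" where
  "gh_dist X Y = gh_filtered (filtered_of X) (filtered_of Y)"

text \<open>\<open>gh_filtered\<close> is invariant under isomorphism, so \<open>gh_dist\<close> does not depend on the
  choice of the colimit, and it agrees with \<open>gh_filtered\<close> on \<open>\<real>\<close>-filtered closure spaces.\<close>

definition filtered_iso :: "'a cfiltration \<Rightarrow> 'b cfiltration \<Rightarrow> ('a \<Rightarrow> 'b) \<Rightarrow> bool" where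
  "filtered_iso X X' h \<longleftrightarrow> inj_on h (total_set X) \<and>
    (\<forall>t. pts (at_time X' t) = h ` pts (at_time X t)) \<and>
    (\<forall>t A. A \<subseteq> pts (at_time X t) \<longrightarrow> cl (at_time X' t) (h ` A) = h ` cl (at_time X t) A)"

lemma filtered_cspace_closure_space: "filtered_cspace X \<Longrightarrow> closure_space (at_time X t)"
  unfolding filtered_cspace_def using filtration_trans_map(1)[OF _ order_refl] by blast

lemma filtered_iso_total: "filtered_iso X X' h \<Longrightarrow> total_set X' = h ` total_set X"
  by (auto simp: filtered_iso_def total_set_def)

lemma filtered_iso_inv:
  assumes X: "filtered_cspace X" and h: "filtered_iso X X' h"
  shows "filtered_iso X' X (inv_into (total_set X) h)"
  unfolding filtered_iso_def
proof (intro conjI allI impI)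
  let ?h = "inv_into (total_set X) h"
  have inj: "inj_on h (total_set X)" using h by (simp add: filtered_iso_def)
  have cancel: "?h ` h ` A = A" if "A \<subseteq> pts (at_time X t)" for A t
    by (rule inv_into_image_cancel[OF inj]) (use that in \<open>auto simp: total_set_def\<close>)
  show "inj_on ?h (total_set X')"
    by (simp add: filtered_iso_total[OF h] inj_on_inv_into)
  fix t
  show "pts (at_time X t) = ?h ` pts (at_time X' t)"
    using h cancel[OF order_refl] by (simp add: filtered_iso_def)
  fix A assume "A \<subseteq> pts (at_time X' t)"
  then have "A \<subseteq> h ` pts (at_time X t)" using h by (simp add: filtered_iso_def)
  then obtain B where B: "B \<subseteq> pts (at_time X t)" "A = h ` B" by (rule subset_imageE)
  have "cl (at_time X' t) A = h ` cl (at_time X t) B" using h B by (simp add: filtered_iso_def)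
  then show "cl (at_time X t) (?h ` A) = ?h ` cl (at_time X' t) A"
    using cancel[OF B(1)] B(2)
      cancel[OF closure_spaceD(1)[OF filtered_cspace_closure_space[OF X] B(1)]] by simp
qed

lemma correspondence_transport:
  assumes "correspondence S T C"
  shows "correspondence (h ` S) (k ` T) (map_prod h k ` C)"
  using assms unfolding correspondence_def multivalued_map_def
  by (auto simp: image_image image_iff)

lemma eps_multivalued_map_transport:
  assumes X: "filtered_cspace X"
    and h: "filtered_iso X X' h" and k: "filtered_iso Y Y' k"
    and C: "eps_multivalued_map X Y \<epsilon> C"
  shows "eps_multivalued_map X' Y' \<epsilon> (map_prod h k ` C)"
proof -
  have injh: "inj_on h (total_set X)" and injk: "inj_on k (total_set Y)"
    using h k by (simp_all add: filtered_iso_def)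
  have mv: "C \<subseteq> total_set X \<times> total_set Y" "fst ` C = total_set X"
    using C by (simp_all add: eps_multivalued_map_def multivalued_map_def)
  have C1: "y \<in> pts (at_time Y (t + \<epsilon>))" if "x \<in> pts (at_time X t)" "(x, y) \<in> C" for t x y
    using C that unfolding eps_multivalued_map_def by blast
  have C2: "C `` cl (at_time X t) A \<subseteq> cl (at_time Y (t + \<epsilon>)) (f ` A)"
    if "A \<subseteq> pts (at_time X t)" "subordinate (total_set X) C f" for t A f
    using C that unfolding eps_multivalued_map_def by blast
  have sub: "pts (at_time X t) \<subseteq> total_set X" for t by (auto simp: total_set_def)
  have pull: "\<exists>y. (x, y) \<in> C \<and> y' = k y"
    if x: "x \<in> total_set X" and c: "(h x, y') \<in> map_prod h k ` C" for x y'
  proof -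
    obtain a b where ab: "(a, b) \<in> C" "h x = h a" "y' = k b" using c by auto
    then have "x = a" using mv(1) x by (intro inj_onD[OF injh]) auto
    then show ?thesis using ab by blast
  qed
  show ?thesis
    unfolding eps_multivalued_map_def
  proof (intro conjI allI impI)
    have "fst ` map_prod h k ` C = h ` fst ` C" by (simp add: image_image)
    moreover have "map_prod h k ` C \<subseteq> h ` total_set X \<times> k ` total_set Y"
      using image_mono[OF mv(1), of "map_prod h k"] by auto
    ultimately show "multivalued_map (total_set X') (total_set Y') (map_prod h k ` C)"
      by (simp add: multivalued_map_def filtered_iso_total[OF h] filtered_iso_total[OF k] mv(2))
  next
    fix t x' y' assume xy: "x' \<in> pts (at_time X' t) \<and> (x', y') \<in> map_prod h k ` C"
    then obtain x where x: "x \<in> pts (at_time X t)" "x' = h x"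
      using h by (auto simp: filtered_iso_def)
    then obtain y where y: "(x, y) \<in> C" "y' = k y"
      using pull[OF subsetD[OF sub x(1)], of y'] xy by auto
    show "y' \<in> pts (at_time Y' (t + \<epsilon>))"
      using C1[OF x(1) y(1)] y(2) k by (simp add: filtered_iso_def)
  next
    fix t A' f' assume A': "A' \<subseteq> pts (at_time X' t)"
      and f': "subordinate (total_set X') (map_prod h k ` C) f'"
    have "A' \<subseteq> h ` pts (at_time X t)" using A' h by (simp add: filtered_iso_def)
    then obtain A where A: "A \<subseteq> pts (at_time X t)" "A' = h ` A" by (rule subset_imageE)
    have "\<forall>x \<in> total_set X. \<exists>y. (x, y) \<in> C \<and> f' (h x) = k y"
      using pull f' by (auto simp: subordinate_def filtered_iso_total[OF h])
    then obtain f where f: "\<And>x. x \<in> total_set X \<Longrightarrow> (x, f x) \<in> C \<and> f' (h x) = k (f x)"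
      by metis
    have subf: "subordinate (total_set X) C f" using f by (simp add: subordinate_def)
    have fA: "f ` A \<subseteq> pts (at_time Y (t + \<epsilon>))"
    proof
      fix y assume "y \<in> f ` A"
      then obtain a where a: "a \<in> A" "y = f a" by blast
      then have "a \<in> pts (at_time X t)" using A(1) by blast
      then show "y \<in> pts (at_time Y (t + \<epsilon>))" using C1[of a t y] f[of a] sub[of t] a(2) by auto
    qed
    have kf: "f' ` A' = k ` f ` A"
      unfolding A(2) image_image using A(1) sub f by (intro image_cong) auto
    have clA: "cl (at_time X t) A \<subseteq> total_set X"
      using closure_spaceD(1)[OF filtered_cspace_closure_space[OF X] A(1)] sub by blast
    have clA': "cl (at_time X' t) A' = h ` cl (at_time X t) A"
      using h A by (simp add: filtered_iso_def)
    have "(map_prod h k ` C) `` cl (at_time X' t) A' \<subseteq> k ` (C `` cl (at_time X t) A)"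
    proof
      fix y' assume "y' \<in> (map_prod h k ` C) `` cl (at_time X' t) A'"
      then obtain x' where x': "(x', y') \<in> map_prod h k ` C" "x' \<in> cl (at_time X' t) A'"
        by (rule ImageE)
      from x'(2) obtain x where x: "x' = h x" "x \<in> cl (at_time X t) A"
        unfolding clA' by (rule imageE)
      obtain y where "(x, y) \<in> C" "y' = k y"
        using pull[OF subsetD[OF clA x(2)]] x'(1) unfolding x(1) by meson
      then show "y' \<in> k ` (C `` cl (at_time X t) A)" using x(2) by (intro image_eqI ImageI)
    qed
    also have "\<dots> \<subseteq> k ` cl (at_time Y (t + \<epsilon>)) (f ` A)" by (rule image_mono[OF C2[OF A(1) subf]])
    also have "\<dots> = cl (at_time Y' (t + \<epsilon>)) (f' ` A')"
      using k fA by (simp add: filtered_iso_def kf)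
    finally show "(map_prod h k ` C) `` cl (at_time X' t) A'
      \<subseteq> cl (at_time Y' (t + \<epsilon>)) (f' ` A')" .
  qed
qed

lemma gh_filtered_iso_le:
  assumes X: "filtered_cspace X" and Y: "filtered_cspace Y"
    and h: "filtered_iso X X' h" and k: "filtered_iso Y Y' k"
  shows "gh_filtered X' Y' \<le> gh_filtered X Y"
proof -
  have corr: "correspondence (total_set X') (total_set Y') (map_prod h k ` C)"
    if "correspondence (total_set X) (total_set Y) C" for C
    using correspondence_transport[OF that, of h k]
    by (simp add: filtered_iso_total[OF h] filtered_iso_total[OF k])
  have conv_eq: "(map_prod h k ` C)\<inverse> = map_prod k h ` C\<inverse>" for C by force
  have "eps_correspondence X' Y' \<epsilon> (map_prod h k ` C)" if "eps_correspondence X Y \<epsilon> C" for \<epsilon> C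
    using that corr eps_multivalued_map_transport[OF X h k]
      eps_multivalued_map_transport[OF Y k h, of \<epsilon> "C\<inverse>"]
    unfolding eps_correspondence_def conv_eq by blast
  then have "corr_dist X' Y' (map_prod h k ` C) \<le> corr_dist X Y C" for C
    unfolding corr_dist_def by (intro Inf_superset_mono) blast
  then have "Inf {corr_dist X' Y' C | C. correspondence (total_set X') (total_set Y') C}
    \<le> Inf {corr_dist X Y C | C. correspondence (total_set X) (total_set Y) C}"
    using corr by (intro Inf_mono) blast
  then show ?thesis unfolding gh_filtered_def by (rule divide_right_mono_ennreal)
qed

lemma gh_filtered_iso:
  assumes "filtered_cspace X" "filtered_cspace Y" "filtered_cspace X'" "filtered_cspace Y'"
    and "filtered_iso X X' h" "filtered_iso Y Y' k"
  shows "gh_filtered X' Y' = gh_filtered X Y"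
  using gh_filtered_iso_le[OF assms(1,2,5,6)]
    gh_filtered_iso_le[OF assms(3,4) filtered_iso_inv[OF assms(1,5)] filtered_iso_inv[OF assms(2,6)]]
  by (rule antisym)

lemma filtered_iso_filtered_of:
  assumes X: "filtered_cspace X"
  shows "\<exists>h. filtered_iso X (filtered_of X) h"
proof -
  have F: "filtration X" using X by (simp add: filtered_cspace_def)
  have mono: "pts (at_time X s) \<subseteq> pts (at_time X t)" if "s \<le> t" for s t
    using X that unfolding filtered_cspace_def by blast
  have le: "colim_in X s x = colim_in X t x" if "s \<le> t" "x \<in> pts (at_time X s)" for s t x
    using colim_in_trans_map[OF F that] X that by (simp add: filtered_cspace_def)
  have indep: "colim_in X s x = colim_in X t x"
    if "x \<in> pts (at_time X s)" "x \<in> pts (at_time X t)" for s t x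
  proof (cases "s \<le> t")
    case True
    then show ?thesis by (rule le[OF _ that(1)])
  next
    case False
    then have "t \<le> s" by simp
    then show ?thesis by (rule le[OF _ that(2), symmetric])
  qed
  define h where "h x = colim_in X (SOME t. x \<in> pts (at_time X t)) x" for x
  have h: "h x = colim_in X t x" if "x \<in> pts (at_time X t)" for x t
    unfolding h_def by (rule indep[OF someI that]) (rule that)
  have img: "h ` A = colim_in X t ` A" if "A \<subseteq> pts (at_time X t)" for A t
    by (rule image_cong[OF refl h]) (use that in blast)
  have "filtered_iso X (filtered_of X) h"
    unfolding filtered_iso_def
  proof (intro conjI allI impI)
    show "inj_on h (total_set X)"
    proof (rule inj_onI)
      fix x y assume "x \<in> total_set X" "y \<in> total_set X" and e: "h x = h y"
      then obtain s t where st: "x \<in> pts (at_time X s)" "y \<in> pts (at_time X t)"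
        by (auto simp: total_set_def)
      let ?m = "max s t"
      have m: "x \<in> pts (at_time X ?m)" "y \<in> pts (at_time X ?m)"
        using subsetD[OF mono, of s ?m] subsetD[OF mono, of t ?m] st by simp_all
      have "colim_in X ?m x = colim_in X ?m y" using e unfolding h[OF m(1)] h[OF m(2)] .
      then show "x = y" by (rule inj_onD[OF colim_in_inj[OF F] _ m])
    qed
    fix t
    show "pts (at_time (filtered_of X) t) = h ` pts (at_time X t)"
      using img[OF order_refl] by (simp add: filtered_of_def colim_image_def)
    fix A assume A: "A \<subseteq> pts (at_time X t)"
    have cA: "cl (at_time X t) A \<subseteq> pts (at_time X t)"
      by (rule closure_spaceD(1)[OF filtered_cspace_closure_space[OF X] A])
    show "cl (at_time (filtered_of X) t) (h ` A) = h ` cl (at_time X t) A"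
      unfolding img[OF A] img[OF cA] using colim_image_cl[OF F A] by (simp add: filtered_of_def)
  qed
  then show ?thesis by blast
qed

lemma gh_dist_filtered:
  assumes X: "filtered_cspace X" and Y: "filtered_cspace Y"
  shows "gh_dist X Y = gh_filtered X Y"
proof -
  obtain h where h: "filtered_iso X (filtered_of X) h"
    using filtered_iso_filtered_of[OF X] ..
  obtain k where k: "filtered_iso Y (filtered_of Y) k"
    using filtered_iso_filtered_of[OF Y] ..
  have F: "filtered_cspace (filtered_of X)" "filtered_cspace (filtered_of Y)"
    using X Y by (simp_all add: filtered_cspace_filtered_of filtered_cspace_def[of X]
        filtered_cspace_def[of Y])
  show ?thesis unfolding gh_dist_def by (rule gh_filtered_iso[OF X Y F h k])
qed

section \<open>Interleavings\<close>

definition interleaved :: "('o, 'm) category \<Rightarrow> real \<Rightarrow>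
    (real, real \<times> real, 'o, 'm) ftor \<Rightarrow> (real, real \<times> real, 'o, 'm) ftor \<Rightarrow> bool" where
  "interleaved D \<epsilon> M N \<longleftrightarrow> (\<exists>\<phi> \<psi>.
    (\<forall>p. \<phi> p \<in> Hom D (on_obj M p) (on_obj N (p + \<epsilon>))) \<and>
    (\<forall>p. \<psi> p \<in> Hom D (on_obj N p) (on_obj M (p + \<epsilon>))) \<and>
    (\<forall>p q. p \<le> q \<longrightarrow>
      Comp D (on_arr N (p + \<epsilon>, q + \<epsilon>)) (\<phi> p) = Comp D (\<phi> q) (on_arr M (p, q))) \<and>
    (\<forall>p q. p \<le> q \<longrightarrow>
      Comp D (on_arr M (p + \<epsilon>, q + \<epsilon>)) (\<psi> p) = Comp D (\<psi> q) (on_arr N (p, q))) \<and>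
    (\<forall>p. Comp D (\<psi> (p + \<epsilon>)) (\<phi> p) = on_arr M (p, p + 2 * \<epsilon>)) \<and>
    (\<forall>p. Comp D (\<phi> (p + \<epsilon>)) (\<psi> p) = on_arr N (p, p + 2 * \<epsilon>)))"

definition interleaving_dist :: "('o, 'm) category \<Rightarrow>
    (real, real \<times> real, 'o, 'm) ftor \<Rightarrow> (real, real \<times> real, 'o, 'm) ftor \<Rightarrow> ennreal" where
  "interleaving_dist D M N = Inf {ennreal \<epsilon> | \<epsilon>. 0 \<le> \<epsilon> \<and> interleaved D \<epsilon> M N}"

end

(* Every function subordinate to a continuous multivalued map is continuous, and any two such
   functions are one-step homotopic, since the choice between their values can be absorbed into the
   choice of a subordinate function. As continuous multivalued maps compose, a homotopy invariant
   functor turns subordinate choices from an \<epsilon>-correspondence and its converse into a strict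
   \<epsilon>-interleaving. The spaces of the \<real>-filtered closure spaces in the colimits do not
   lie in the domain of H, so the correspondence is pulled back along the colimit legs first. *)
theory Submission
  imports Defs
begin

section \<open>Continuous multivalued maps\<close>

text \<open>The closure condition of an \<epsilon>-multivalued map for a single pair of spaces, with
  filtrations and shift removed, so that such relations can be composed.\<close>

definition cts_multivalued :: "'a cspace \<Rightarrow> 'b cspace \<Rightarrow> ('a \<times> 'b) set \<Rightarrow> bool" where
  "cts_multivalued S T R \<longleftrightarrow> multivalued_map (pts S) (pts T) R \<and>
    (\<forall>A f. A \<subseteq> pts S \<longrightarrow> subordinate (pts S) R f \<longrightarrow> R `` cl S A \<subseteq> cl T (f ` A))"

lemma cts_multivaluedD:
  assumes "cts_multivalued S T R"
  shows "(x, y) \<in> R \<Longrightarrow> x \<in> pts S" "(x, y) \<in> R \<Longrightarrow> y \<in> pts T"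
    "x \<in> pts S \<Longrightarrow> \<exists>y. (x, y) \<in> R"
    "A \<subseteq> pts S \<Longrightarrow> subordinate (pts S) R f \<Longrightarrow> x \<in> cl S A \<Longrightarrow> (x, y) \<in> R \<Longrightarrow> y \<in> cl T (f ` A)"
proof -
  have "R \<subseteq> pts S \<times> pts T" "fst ` R = pts S"
    using assms by (simp_all add: cts_multivalued_def multivalued_map_def)
  then show "(x, y) \<in> R \<Longrightarrow> x \<in> pts S" "(x, y) \<in> R \<Longrightarrow> y \<in> pts T"
    "x \<in> pts S \<Longrightarrow> \<exists>y. (x, y) \<in> R"
    by force+
  show "y \<in> cl T (f ` A)"
    if "A \<subseteq> pts S" "subordinate (pts S) R f" "x \<in> cl S A" "(x, y) \<in> R"
    using assms that unfolding cts_multivalued_def by blast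
qed

lemma cts_multivaluedI:
  assumes "\<And>x y. (x, y) \<in> R \<Longrightarrow> x \<in> pts S \<and> y \<in> pts T"
    and "\<And>x. x \<in> pts S \<Longrightarrow> \<exists>y. (x, y) \<in> R"
    and "\<And>A f x y. A \<subseteq> pts S \<Longrightarrow> subordinate (pts S) R f \<Longrightarrow> x \<in> cl S A \<Longrightarrow> (x, y) \<in> R \<Longrightarrow>
      y \<in> cl T (f ` A)"
  shows "cts_multivalued S T R"
proof -
  have "R \<subseteq> pts S \<times> pts T" using assms(1) by auto
  moreover have "fst ` R = pts S" using assms(1,2) by force
  moreover have "R `` cl S A \<subseteq> cl T (f ` A)" if "A \<subseteq> pts S" "subordinate (pts S) R f" for A f
    using assms(3)[OF that] by blast
  ultimately show ?thesis
    unfolding cts_multivalued_def multivalued_map_def by blast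
qed

section \<open>Graphs and composites\<close>

text \<open>A function subordinate to a graph agrees with \<open>f\<close> on \<open>pts S\<close>,
  so the closure condition reduces to continuity. This lets transition maps enter
  composites.\<close>

lemma cts_multivalued_graph:
  assumes "cts S T f" and S: "closure_space S"
  shows "cts_multivalued S T {(x, y). x \<in> pts S \<and> y = f x}"
proof (rule cts_multivaluedI)
  fix A g x y
  assume A: "A \<subseteq> pts S" and g: "subordinate (pts S) {(x, y). x \<in> pts S \<and> y = f x} g"
    and x: "x \<in> cl S A" and y: "(x, y) \<in> {(x, y). x \<in> pts S \<and> y = f x}"
  have "g ` A = f ` A" by (rule image_cong) (use A g in \<open>auto simp: subordinate_def\<close>)
  then show "y \<in> cl T (g ` A)" using ctsD(2)[OF assms(1) A] x y by auto
qed (use ctsD(1)[OF assms(1)] in auto)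

lemma cts_multivalued_relcomp:
  assumes U: "closure_space U" and R: "cts_multivalued S T R" and Q: "cts_multivalued T U Q"
  shows "cts_multivalued S U (R O Q)"
proof (rule cts_multivaluedI)
  show "x \<in> pts S \<and> z \<in> pts U" if "(x, z) \<in> R O Q" for x z
    using that cts_multivaluedD(1)[OF R] cts_multivaluedD(2)[OF Q] by blast
  show "\<exists>z. (x, z) \<in> R O Q" if x: "x \<in> pts S" for x
  proof -
    obtain y where y: "(x, y) \<in> R" using cts_multivaluedD(3)[OF R x] ..
    obtain z where "(y, z) \<in> Q" using cts_multivaluedD(3)[OF Q cts_multivaluedD(2)[OF R y]] ..
    with y show ?thesis by blast
  qed
  fix A h x z
  assume A: "A \<subseteq> pts S" and h: "subordinate (pts S) (R O Q) h" and x: "x \<in> cl S A"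
    and z: "(x, z) \<in> R O Q"
  have "\<forall>x \<in> pts S. \<exists>y. (x, y) \<in> R \<and> (y, h x) \<in> Q"
    using h by (auto simp: subordinate_def)
  then obtain f where f: "\<And>x. x \<in> pts S \<Longrightarrow> (x, f x) \<in> R \<and> (f x, h x) \<in> Q" by metis
  (* h need not factor through f, so g picks one value of h on each fibre of f over f ` A. *)
  have "\<forall>y \<in> pts T. \<exists>z. (y, z) \<in> Q \<and> (y \<in> f ` A \<longrightarrow> z \<in> h ` A)"
  proof
    fix y assume y: "y \<in> pts T"
    show "\<exists>z. (y, z) \<in> Q \<and> (y \<in> f ` A \<longrightarrow> z \<in> h ` A)"
    proof (cases "y \<in> f ` A")
      case True
      then obtain a where a: "a \<in> A" "y = f a" by blast
      then have "(y, h a) \<in> Q" using f A by blast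
      then show ?thesis using a(1) by blast
    next
      case False
      then show ?thesis using cts_multivaluedD(3)[OF Q y] by blast
    qed
  qed
  then obtain g where g: "\<And>y. y \<in> pts T \<Longrightarrow> (y, g y) \<in> Q \<and> (y \<in> f ` A \<longrightarrow> g y \<in> h ` A)"
    by metis
  have fA: "f ` A \<subseteq> pts T" using A f cts_multivaluedD(2)[OF R] by blast
  obtain y where y: "(x, y) \<in> R" "(y, z) \<in> Q" using z by blast
  have "y \<in> cl T (f ` A)"
    by (rule cts_multivaluedD(4)[OF R A _ x y(1)]) (use f in \<open>simp add: subordinate_def\<close>)
  then have "z \<in> cl U (g ` f ` A)"
    by (rule cts_multivaluedD(4)[OF Q fA _ _ y(2), rotated]) (use g in \<open>simp add: subordinate_def\<close>)
  moreover have "h ` A \<subseteq> pts U" using A f cts_multivaluedD(2)[OF Q] by blast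
  moreover have "g ` f ` A \<subseteq> h ` A" using g fA by blast
  ultimately show "z \<in> cl U (h ` A)" using cl_mono[OF U] by blast
qed

section \<open>Subordinate functions and their homotopies\<close>

text \<open>The value \<open>f x\<close> is one of the values of \<open>R\<close> at
  \<open>x\<close>, so the closure condition taken with \<open>f\<close> itself is
  continuity.\<close>

lemma cts_subordinate:
  assumes S: "closure_space S" and R: "cts_multivalued S T R" and f: "subordinate (pts S) R f"
  shows "cts S T f"
proof -
  have fR: "(x, f x) \<in> R" if "x \<in> pts S" for x using f that by (simp add: subordinate_def)
  have "f x \<in> cl T (f ` A)" if A: "A \<subseteq> pts S" and x: "x \<in> cl S A" for A x
    using cts_multivaluedD(4)[OF R A f x] fR closure_spaceD(1)[OF S A] x by blast
  then show ?thesis using fR cts_multivaluedD(2)[OF R] unfolding cts_def by blast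
qed

lemma subordinate_arrow_exists:
  assumes S: "closure_space S" and T: "closure_space T" and R: "cts_multivalued S T R"
  shows "\<exists>f \<in> Hom Cl S T. subordinate (pts S) R (app f)"
proof -
  \<comment> \<open>The restriction makes the choice extensional, as arrows of \<open>Cl\<close>
    must be.\<close>
  define f where "f = (\<lambda>x \<in> pts S. SOME y. (x, y) \<in> R)"
  have f: "subordinate (pts S) R f"
    using someI_ex[OF cts_multivaluedD(3)[OF R]] by (simp add: subordinate_def f_def)
  have "\<lparr>src = S, tgt = T, app = f\<rparr> \<in> Hom Cl S T"
    using S T cts_subordinate[OF S R f] by (simp add: Hom_Cl_iff f_def)
  then show ?thesis using f by force
qed

text \<open>Continuity of the first projection: if \<open>x\<close> is outside the closure of
  \<open>fst\<close> A\<open>, then the complement of\<close>fst \<open>A\<close> is a neighborhood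
  of \<open>x\<close> whose product with all of \<open>pts T\<close> misses
  \<open>A\<close>.\<close>

lemma fst_cl_prod_cspace:
  assumes S: "closure_space S" and T: "closure_space T"
    and A: "A \<subseteq> pts S \<times> pts T" and xy: "(x, y) \<in> cl (prod_cspace S T) A"
  shows "x \<in> cl S (fst ` A)"
proof (rule ccontr)
  assume x: "x \<notin> cl S (fst ` A)"
  have xy': "x \<in> pts S" "y \<in> pts T"
    "\<And>U V. nbhd S x U \<Longrightarrow> nbhd T y V \<Longrightarrow> (U \<times> V) \<inter> A \<noteq> {}"
    using xy A by (auto simp: prod_cspace_def)
  have "pts S - (pts S - fst ` A) = fst ` A" using A by auto
  then have "nbhd S x (pts S - fst ` A)" using x xy'(1) by (simp add: nbhd_def)
  moreover have "nbhd T y (pts T)" using xy'(2) closure_spaceD(3)[OF T] by (simp add: nbhd_def)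
  ultimately have "((pts S - fst ` A) \<times> pts T) \<inter> A \<noteq> {}" by (rule xy'(3))
  then show False by force
qed

lemma subordinate_one_step_homotopic:
  assumes R: "cts_multivalued S T R"
    and f: "f \<in> Hom Cl S T" "subordinate (pts S) R (app f)"
    and g: "g \<in> Hom Cl S T" "subordinate (pts S) R (app g)"
  shows "one_step_homotopic f g"
proof -
  have S: "closure_space S" and T: "closure_space T" using f(1) by (simp_all add: Hom_Cl_iff)
  \<comment> \<open>Every nonzero level carries \<open>g\<close>, so \<open>K (x, i)\<close> is a
    value of \<open>R\<close> at \<open>x\<close> for every natural number \<open>i\<close>.\<close>
  define K where "K = (\<lambda>(x, i :: nat). if i = 0 then app f x else app g x)"
  have KR: "(x, K (x, i)) \<in> R" if "x \<in> pts S" for x i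
    using that f(2) g(2) by (simp add: K_def subordinate_def)
  have KT: "K (x, i) \<in> pts T" if "x \<in> pts S" for x i
    using cts_multivaluedD(2)[OF R KR[OF that]] .
  have "cts (prod_cspace S J_top) T K"
    unfolding cts_def
  proof (intro conjI allI impI subsetI)
    show "K \<in> pts (prod_cspace S J_top) \<rightarrow> pts T"
      using KT by (auto simp: prod_cspace_def)
    fix A z assume "A \<subseteq> pts (prod_cspace S J_top)" and z: "z \<in> K ` cl (prod_cspace S J_top) A"
    then have A: "A \<subseteq> pts S \<times> pts J_top" by (simp add: prod_cspace_def)
    then have fA: "fst ` A \<subseteq> pts S" by auto
    obtain x i where xi: "(x, i) \<in> cl (prod_cspace S J_top) A" "z = K (x, i)" using z by auto
    have x: "x \<in> cl S (fst ` A)" by (rule fst_cl_prod_cspace[OF S closure_space_J_top A xi(1)])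
    \<comment> \<open>Over a point of \<open>fst\<close>
      A\<open>the chosen level stays inside\<close>A\<open>, so\<close>s\<open>takes values in\<close>K
      \<open>A\<close>; elsewhere the level is arbitrary, but \<open>s\<close> is still subordinate
      to \<open>R\<close>.\<close>
    define s where "s x = K (x, SOME i. (x, i) \<in> A)" for x
    have "s x \<in> K ` A" if "x \<in> fst ` A" for x
    proof -
      have "\<exists>i. (x, i) \<in> A" using that by force
      then have "(x, SOME i. (x, i) \<in> A) \<in> A" by (rule someI_ex)
      then show ?thesis unfolding s_def by (rule imageI)
    qed
    then have "s ` fst ` A \<subseteq> K ` A" by blast
    moreover have "K ` A \<subseteq> pts T" using A KT by auto
    ultimately have "cl T (s ` fst ` A) \<subseteq> cl T (K ` A)" by (rule cl_mono[OF T])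
    \<comment> \<open>The closure condition covers all values of \<open>R\<close> at
      \<open>x\<close>, so the level \<open>i\<close> of the limit point does not matter.\<close>
    moreover have "z \<in> cl T (s ` fst ` A)"
      unfolding xi(2)
    proof (rule cts_multivaluedD(4)[OF R fA _ x])
      show "subordinate (pts S) R s" using KR by (simp add: subordinate_def s_def)
      show "(x, K (x, i)) \<in> R" using KR closure_spaceD(1)[OF S fA] x by blast
    qed
    ultimately show "z \<in> cl T (K ` A)" by blast
  qed
  moreover have "K (x, 0) = app f x \<and> K (x, 1) = app g x" for x by (simp add: K_def)
  ultimately show ?thesis
    using f(1) g(1) unfolding one_step_homotopic_def Hom_Cl_iff
    by (auto simp: Cl_def)
qed

text \<open>The tool for all interleaving identities: it suffices to exhibit one continuous
  multivalued map to which both sides are subordinate.\<close>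

lemma homotopy_invariant_subordinate:
  assumes "homotopy_invariant H" and R: "cts_multivalued S T R"
    and f: "f \<in> Hom Cl S T" "subordinate (pts S) R (app f)"
    and g: "g \<in> Hom Cl S T" "subordinate (pts S) R (app g)"
  shows "on_arr H f = on_arr H g"
proof -
  have "homotopic f g"
    using subordinate_one_step_homotopic[OF R f g] by (simp add: homotopic_def r_into_equivclp)
  then show ?thesis using assms(1) f(1) g(1) by (simp add: homotopy_invariant_def Hom_def)
qed

section \<open>Pulling a correspondence back along the colimit\<close>

text \<open>The two times are independent because the triangle identities also relate points of
  \<open>X\<close> at a later time than their partners in \<open>Y\<close>.\<close>

definition pullback_rel ::
  "'a cfiltration \<Rightarrow> 'b cfiltration \<Rightarrow> ((real \<times> 'a) set \<times> (real \<times> 'b) set) set \<Rightarrow>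
    real \<Rightarrow> real \<Rightarrow> ('a \<times> 'b) set" where
  "pullback_rel X Y C s t = {(x, y). x \<in> pts (at_time X s) \<and> y \<in> pts (at_time Y t) \<and>
    (colim_in X s x, colim_in Y t y) \<in> C}"

text \<open>The legs commute with the transition maps, so moving forward in time does not change the
  points of the colimits.\<close>

lemma pullback_rel_trans_map:
  assumes X: "filtration X" and Y: "filtration Y" and "s \<le> s'" "t \<le> t'"
    and xy: "(x, y) \<in> pullback_rel X Y C s t"
  shows "(trans_map X s s' x, trans_map Y t t' y) \<in> pullback_rel X Y C s' t'"
  using assms ctsD(1)[OF filtration_trans_map(2)[OF X \<open>s \<le> s'\<close>]]
    ctsD(1)[OF filtration_trans_map(2)[OF Y \<open>t \<le> t'\<close>]]
  by (simp add: pullback_rel_def colim_in_trans_map)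

lemma pullback_rel_converse:
  "(x, y) \<in> pullback_rel X Y C s t \<longleftrightarrow> (y, x) \<in> pullback_rel Y X (C\<inverse>) t s"
  by (auto simp: pullback_rel_def)

text \<open>The legs are injective and carry the closures of \<open>X\<close> and \<open>Y\<close>
  to those of the images, so the conditions on \<open>C\<close> can be read back through them.
  Selections must first be extended from one time to the whole union.\<close>

lemma cts_multivalued_pullback_rel:
  assumes X: "filtration X" and Y: "filtration Y"
    and C: "eps_multivalued_map (filtered_of X) (filtered_of Y) \<epsilon> C"
  shows "cts_multivalued (at_time X p) (at_time Y (p + \<epsilon>)) (pullback_rel X Y C p (p + \<epsilon>))"
proof (rule cts_multivaluedI)
  let ?q = "p + \<epsilon>" and ?R = "pullback_rel X Y C p (p + \<epsilon>)"
  let ?i = "colim_in X p" and ?j = "colim_in Y ?q"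
  have pX: "pts (at_time (filtered_of X) p) = ?i ` pts (at_time X p)"
    and pY: "pts (at_time (filtered_of Y) ?q) = ?j ` pts (at_time Y ?q)"
    by (simp_all add: filtered_of_def colim_image_def)
  have dom: "fst ` C = total_set (filtered_of X)"
    using C by (simp add: eps_multivalued_map_def multivalued_map_def)
  have tot: "?i x \<in> total_set (filtered_of X)" if "x \<in> pts (at_time X p)" for x
    using that pX unfolding total_set_def by blast
  show "x \<in> pts (at_time X p) \<and> y \<in> pts (at_time Y ?q)" if "(x, y) \<in> ?R" for x y
    using that by (simp add: pullback_rel_def)
  show "\<exists>y. (x, y) \<in> ?R" if x: "x \<in> pts (at_time X p)" for x
  proof -
    obtain w where w: "(?i x, w) \<in> C" using tot[OF x] unfolding dom[symmetric] by force
    have "?i x \<in> pts (at_time (filtered_of X) p)" using x pX by blast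
    \<comment> \<open>The first condition on \<open>C\<close> forces every partner of a point at
      time \<open>p\<close> to come from \<open>Y\<close> at time
      \<open>p + \<epsilon>\<close>.\<close>
    then have "w \<in> pts (at_time (filtered_of Y) ?q)"
      using C w unfolding eps_multivalued_map_def by blast
    then show ?thesis using x w unfolding pY by (auto simp: pullback_rel_def)
  qed
  fix A f x y
  assume A: "A \<subseteq> pts (at_time X p)" and f: "subordinate (pts (at_time X p)) ?R f"
    and x: "x \<in> cl (at_time X p) A" and y: "(x, y) \<in> ?R"
  have clY: "closure_space (at_time Y ?q)" by (rule filtration_trans_map(1)[OF Y order_refl])
  have fR: "f x \<in> pts (at_time Y ?q)" "(?i x, ?j (f x)) \<in> C" if "x \<in> pts (at_time X p)" for x
    using f that by (simp_all add: subordinate_def pullback_rel_def)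
  have fA: "f ` A \<subseteq> pts (at_time Y ?q)" using fR A by blast
  define f' where "f' z = (if z \<in> ?i ` pts (at_time X p)
    then ?j (f (inv_into (pts (at_time X p)) ?i z)) else SOME w. (z, w) \<in> C)" for z
  have f'i: "f' (?i x) = ?j (f x)" if "x \<in> pts (at_time X p)" for x
    using that by (simp add: f'_def inv_into_f_f[OF colim_in_inj[OF X]])
  have f': "subordinate (total_set (filtered_of X)) C f'"
    unfolding subordinate_def
  proof
    fix z assume z: "z \<in> total_set (filtered_of X)"
    show "(z, f' z) \<in> C"
    proof (cases "z \<in> ?i ` pts (at_time X p)")
      case True
      then obtain x where "x \<in> pts (at_time X p)" "z = ?i x" by blast
      then show ?thesis using fR(2) f'i by simp
    next
      case False
      have "\<exists>w. (z, w) \<in> C" using z unfolding dom[symmetric] by force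
      then show ?thesis using False someI_ex by (simp add: f'_def)
    qed
  qed
  have iA: "?i ` A \<subseteq> pts (at_time (filtered_of X) p)" using A unfolding pX by blast
  have "f' ` ?i ` A = ?j ` f ` A" unfolding image_image
    by (rule image_cong) (use A f'i in auto)
  moreover have "C `` cl (at_time (filtered_of X) p) (?i ` A)
      \<subseteq> cl (at_time (filtered_of Y) ?q) (f' ` ?i ` A)"
    using C iA f' unfolding eps_multivalued_map_def by blast
  ultimately have "C `` (?i ` cl (at_time X p) A) \<subseteq> ?j ` cl (at_time Y ?q) (f ` A)"
    using colim_image_cl[OF X A] colim_image_cl[OF Y fA] by (simp add: filtered_of_def)
  moreover have "y \<in> pts (at_time Y ?q)" "(?i x, ?j y) \<in> C"
    using y by (simp_all add: pullback_rel_def)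
  \<comment> \<open>Injectivity of the leg \<open>?j\<close> removes it from both sides.\<close>
  ultimately show "y \<in> cl (at_time Y ?q) (f ` A)"
    using x inj_on_image_mem_iff[OF colim_in_inj[OF Y] _ closure_spaceD(1)[OF clY fA]] by blast
qed

section \<open>Interleavings from correspondences\<close>

lemma filtration_arr_Hom:
  assumes "filtration X" "s \<le> t"
  shows "on_arr X (s, t) \<in> Hom Cl (at_time X s) (at_time X t)"
  using filtration_trans_map[OF assms] filtration_trans_map(1)[OF assms(1) order_refl, of t]
  by (simp add: Hom_Cl_iff)

lemma app_Comp_Cl: "x \<in> pts (src f) \<Longrightarrow> app (Comp Cl g f) x = app g (app f x)"
  by (simp add: Cl_def compose_def)

section \<open>Squares and triangles after applying \<open>H\<close>\<close>

text \<open>Both ways around the square are selections of one relation: move \<open>x\<close> to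
  time \<open>q\<close>, then take any partner at time \<open>q + \<epsilon>\<close>. For the path
  through \<open>\<phi> p\<close>, this holds because moving both members of a related pair forward
  keeps them related.\<close>

lemma subordinate_naturality:
  assumes X: "filtration X" and Y: "filtration Y"
    and H: "is_functor Cl D H" and inv: "homotopy_invariant H"
    and C: "eps_multivalued_map (filtered_of X) (filtered_of Y) \<epsilon> C"
    and \<phi>: "\<And>p. \<phi> p \<in> Hom Cl (at_time X p) (at_time Y (p + \<epsilon>))"
    and sub: "\<And>p. subordinate (pts (at_time X p)) (pullback_rel X Y C p (p + \<epsilon>)) (app (\<phi> p))"
    and pq: "p \<le> q"
  shows "Comp D (on_arr H (on_arr Y (p + \<epsilon>, q + \<epsilon>))) (on_arr H (\<phi> p))
    = Comp D (on_arr H (\<phi> q)) (on_arr H (on_arr X (p, q)))"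
proof -
  interpret Cl: category Cl by (rule category_Cl)
  let ?a = "on_arr X (p, q)" and ?b = "on_arr Y (p + \<epsilon>, q + \<epsilon>)"
  let ?R = "{(x, y). x \<in> pts (at_time X p) \<and> y = trans_map X p q x}
    O pullback_rel X Y C q (q + \<epsilon>)"
  have a: "?a \<in> Hom Cl (at_time X p) (at_time X q)"
    by (rule filtration_arr_Hom[OF X pq])
  have b: "?b \<in> Hom Cl (at_time Y (p + \<epsilon>)) (at_time Y (q + \<epsilon>))"
    by (rule filtration_arr_Hom[OF Y]) (use pq in simp)
  have R: "cts_multivalued (at_time X p) (at_time Y (q + \<epsilon>)) ?R"
    by (rule cts_multivalued_relcomp[OF filtration_trans_map(1)[OF Y order_refl]
        cts_multivalued_graph[OF filtration_trans_map(2,1)[OF X pq]]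
        cts_multivalued_pullback_rel[OF X Y C]])
  have srcs: "src (\<phi> p) = at_time X p" "src ?a = at_time X p"
    using \<phi>[of p] a by (simp_all add: Hom_Cl_iff)
  have "on_arr H (Comp Cl ?b (\<phi> p)) = on_arr H (Comp Cl (\<phi> q) ?a)"
  proof (rule homotopy_invariant_subordinate[OF inv R])
    show "Comp Cl ?b (\<phi> p) \<in> Hom Cl (at_time X p) (at_time Y (q + \<epsilon>))"
      by (rule Cl.Comp_Hom[OF \<phi> b])
    show "Comp Cl (\<phi> q) ?a \<in> Hom Cl (at_time X p) (at_time Y (q + \<epsilon>))"
      by (rule Cl.Comp_Hom[OF a \<phi>])
    show "subordinate (pts (at_time X p)) ?R (app (Comp Cl ?b (\<phi> p)))"
      unfolding subordinate_def
    proof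
      fix x assume x: "x \<in> pts (at_time X p)"
      then have "(x, app (\<phi> p) x) \<in> pullback_rel X Y C p (p + \<epsilon>)"
        using sub by (simp add: subordinate_def)
      from pullback_rel_trans_map[OF X Y pq _ this, of "q + \<epsilon>"] pq x
      show "(x, app (Comp Cl ?b (\<phi> p)) x) \<in> ?R"
        by (auto simp: app_Comp_Cl srcs)
    qed
    show "subordinate (pts (at_time X p)) ?R (app (Comp Cl (\<phi> q) ?a))"
      unfolding subordinate_def
    proof
      fix x assume x: "x \<in> pts (at_time X p)"
      then have "trans_map X p q x \<in> pts (at_time X q)"
        using ctsD(1)[OF filtration_trans_map(2)[OF X pq]] by blast
      then have "(trans_map X p q x, app (\<phi> q) (trans_map X p q x)) \<in> pullback_rel X Y C q (q + \<epsilon>)"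
        using sub by (simp add: subordinate_def)
      then show "(x, app (Comp Cl (\<phi> q) ?a) x) \<in> ?R"
        using x by (auto simp: app_Comp_Cl srcs)
    qed
  qed
  then show ?thesis
    using is_functorD(4)[OF H, of "\<phi> p" ?b] is_functorD(4)[OF H, of ?a "\<phi> q"] \<phi>[of p] \<phi>[of q] a b
    by (simp add: Hom_def)
qed

text \<open>The round trip and the transition map are both selections of \<open>C\<close> followed
  by \<open>C\<inverse>\<close>: among the points reached back from a partner of \<open>x\<close> is
  \<open>x\<close> itself, moved forward.\<close>

lemma subordinate_triangle:
  assumes X: "filtration X" and Y: "filtration Y"
    and H: "is_functor Cl D H" and inv: "homotopy_invariant H" and \<epsilon>: "0 \<le> \<epsilon>"
    and C: "eps_multivalued_map (filtered_of X) (filtered_of Y) \<epsilon> C"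
    and C': "eps_multivalued_map (filtered_of Y) (filtered_of X) \<epsilon> (C\<inverse>)"
    and \<phi>: "\<phi> \<in> Hom Cl (at_time X p) (at_time Y (p + \<epsilon>))"
    and \<psi>: "\<psi> \<in> Hom Cl (at_time Y (p + \<epsilon>)) (at_time X (p + \<epsilon> + \<epsilon>))"
    and \<phi>C: "subordinate (pts (at_time X p)) (pullback_rel X Y C p (p + \<epsilon>)) (app \<phi>)"
    and \<psi>C: "subordinate (pts (at_time Y (p + \<epsilon>)))
      (pullback_rel Y X (C\<inverse>) (p + \<epsilon>) (p + \<epsilon> + \<epsilon>)) (app \<psi>)"
  shows "Comp D (on_arr H \<psi>) (on_arr H \<phi>) = on_arr H (on_arr X (p, p + 2 * \<epsilon>))"
proof -
  interpret Cl: category Cl by (rule category_Cl)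
  \<comment> \<open>This form of \<open>p + 2 * \<epsilon>\<close> is the one produced by two
    successive shifts.\<close>
  let ?r = "p + \<epsilon> + \<epsilon>"
  let ?R = "pullback_rel X Y C p (p + \<epsilon>) O pullback_rel Y X (C\<inverse>) (p + \<epsilon>) ?r"
  have le: "p \<le> ?r" using \<epsilon> by simp
  have R: "cts_multivalued (at_time X p) (at_time X ?r) ?R"
    by (rule cts_multivalued_relcomp[OF filtration_trans_map(1)[OF X order_refl]
        cts_multivalued_pullback_rel[OF X Y C] cts_multivalued_pullback_rel[OF Y X C']])
  have src: "src \<phi> = at_time X p" using \<phi> by (simp add: Hom_Cl_iff)
  have \<phi>R: "(x, app \<phi> x) \<in> pullback_rel X Y C p (p + \<epsilon>)" if "x \<in> pts (at_time X p)" for x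
    using \<phi>C that by (simp add: subordinate_def)
  have "on_arr H (Comp Cl \<psi> \<phi>) = on_arr H (on_arr X (p, ?r))"
  proof (rule homotopy_invariant_subordinate[OF inv R])
    show "Comp Cl \<psi> \<phi> \<in> Hom Cl (at_time X p) (at_time X ?r)" by (rule Cl.Comp_Hom[OF \<phi> \<psi>])
    show "on_arr X (p, ?r) \<in> Hom Cl (at_time X p) (at_time X ?r)" by (rule filtration_arr_Hom[OF X le])
    show "subordinate (pts (at_time X p)) ?R (app (Comp Cl \<psi> \<phi>))"
      unfolding subordinate_def
    proof
      fix x assume x: "x \<in> pts (at_time X p)"
      have "app \<phi> x \<in> pts (at_time Y (p + \<epsilon>))" using \<phi>R[OF x] by (simp add: pullback_rel_def)
      then have "(app \<phi> x, app \<psi> (app \<phi> x)) \<in> pullback_rel Y X (C\<inverse>) (p + \<epsilon>) ?r"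
        using \<psi>C by (simp add: subordinate_def)
      with \<phi>R[OF x] x show "(x, app (Comp Cl \<psi> \<phi>) x) \<in> ?R" by (auto simp: app_Comp_Cl src)
    qed
    show "subordinate (pts (at_time X p)) ?R (trans_map X p ?r)"
      unfolding subordinate_def
    proof
      fix x assume x: "x \<in> pts (at_time X p)"
      have y: "app \<phi> x \<in> pts (at_time Y (p + \<epsilon>))" using \<phi>R[OF x] by (simp add: pullback_rel_def)
      \<comment> \<open>Only the point of \<open>X\<close> advances; its partner stays at time
        \<open>p + \<epsilon>\<close>, where the transition map is the identity.\<close>
      have "(trans_map X p ?r x, app \<phi> x) \<in> pullback_rel X Y C ?r (p + \<epsilon>)"
        using pullback_rel_trans_map[OF X Y le order_refl \<phi>R[OF x]] filtration_trans_map_id[OF Y y]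
        by simp
      then show "(x, trans_map X p ?r x) \<in> ?R"
        using \<phi>R[OF x] unfolding pullback_rel_converse[of "trans_map X p ?r x"] by blast
    qed
  qed
  moreover have "?r = p + 2 * \<epsilon>" by simp
  ultimately show ?thesis using is_functorD(4)[OF H, of \<phi> \<psi>] \<phi> \<psi> by (simp add: Hom_def)
qed

text \<open>The selections are made independently for each \<open>p\<close>, with no coherence
  between times; the squares and triangles commute only after \<open>H\<close> is applied.\<close>

lemma interleaved_if_eps_correspondence:
  assumes X: "filtration X" and Y: "filtration Y"
    and H: "is_functor Cl D H" and inv: "homotopy_invariant H" and \<epsilon>: "0 \<le> \<epsilon>"
    and C: "eps_correspondence (filtered_of X) (filtered_of Y) \<epsilon> C"
  shows "interleaved D \<epsilon> (H \<circ>\<^sub>F X) (H \<circ>\<^sub>F Y)"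
proof -
  have CX: "eps_multivalued_map (filtered_of X) (filtered_of Y) \<epsilon> C"
    and CY: "eps_multivalued_map (filtered_of Y) (filtered_of X) \<epsilon> (C\<inverse>)"
    using C by (simp_all add: eps_correspondence_def)
  have cl: "closure_space (at_time X t)" "closure_space (at_time Y t)" for t
    using filtration_trans_map(1)[OF X order_refl] filtration_trans_map(1)[OF Y order_refl] by auto
  obtain \<phi> where \<phi>: "\<And>p. \<phi> p \<in> Hom Cl (at_time X p) (at_time Y (p + \<epsilon>))"
    "\<And>p. subordinate (pts (at_time X p)) (pullback_rel X Y C p (p + \<epsilon>)) (app (\<phi> p))"
    using subordinate_arrow_exists[OF cl cts_multivalued_pullback_rel[OF X Y CX]] by metis
  obtain \<psi> where \<psi>: "\<And>p. \<psi> p \<in> Hom Cl (at_time Y p) (at_time X (p + \<epsilon>))"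
    "\<And>p. subordinate (pts (at_time Y p)) (pullback_rel Y X (C\<inverse>) p (p + \<epsilon>)) (app (\<psi> p))"
    using subordinate_arrow_exists[OF cl(2,1) cts_multivalued_pullback_rel[OF Y X CY]] by metis
  have obj: "at_time X t \<in> Obj Cl" "at_time Y t \<in> Obj Cl" for t
    using cl by (simp_all add: Cl_def)
  \<comment> \<open>With \<open>X\<close> and \<open>Y\<close> exchanged, \<open>C\<inverse>\<close>
    replaces \<open>C\<close>, so the triangle asks for its converse.\<close>
  have CX': "eps_multivalued_map (filtered_of X) (filtered_of Y) \<epsilon> ((C\<inverse>)\<inverse>)" using CX by simp
  show ?thesis
    unfolding interleaved_def ftor_comp_def
  proof (rule exI[of _ "\<lambda>p. on_arr H (\<phi> p)"], rule exI[of _ "\<lambda>p. on_arr H (\<psi> p)"],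
      simp only: ftor.simps o_apply, intro conjI allI impI)
    fix p q :: real
    show "on_arr H (\<phi> p) \<in> Hom D (on_obj H (at_time X p)) (on_obj H (at_time Y (p + \<epsilon>)))"
      by (rule is_functorD(2)[OF H obj \<phi>(1)])
    show "on_arr H (\<psi> p) \<in> Hom D (on_obj H (at_time Y p)) (on_obj H (at_time X (p + \<epsilon>)))"
      by (rule is_functorD(2)[OF H obj(2,1) \<psi>(1)])
    show "Comp D (on_arr H (\<psi> (p + \<epsilon>))) (on_arr H (\<phi> p)) = on_arr H (on_arr X (p, p + 2 * \<epsilon>))"
      by (rule subordinate_triangle[OF X Y H inv \<epsilon> CX CY \<phi>(1) \<psi>(1) \<phi>(2) \<psi>(2)])
    show "Comp D (on_arr H (\<phi> (p + \<epsilon>))) (on_arr H (\<psi> p)) = on_arr H (on_arr Y (p, p + 2 * \<epsilon>))"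
      by (rule subordinate_triangle[OF Y X H inv \<epsilon> CY CX' \<psi>(1) \<phi>(1) \<psi>(2)])
        (simp only: converse_converse \<phi>(2))
    assume pq: "p \<le> q"
    show "Comp D (on_arr H (on_arr Y (p + \<epsilon>, q + \<epsilon>))) (on_arr H (\<phi> p))
      = Comp D (on_arr H (\<phi> q)) (on_arr H (on_arr X (p, q)))"
      by (rule subordinate_naturality[OF X Y H inv CX \<phi> pq])
    show "Comp D (on_arr H (on_arr X (p + \<epsilon>, q + \<epsilon>))) (on_arr H (\<psi> p))
      = Comp D (on_arr H (\<psi> q)) (on_arr H (on_arr Y (p, q)))"
      by (rule subordinate_naturality[OF Y X H inv CY \<psi> pq])
  qed
qed

theorem theorem8p29:
  fixes X Y :: "'u cfiltration"
    and D :: "('o, 'm) category"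
    and H :: "('u cspace, 'u cmap, 'o, 'm) ftor"
  assumes "filtration X" and "filtration Y"
    and "category D"
    and "is_functor Cl D H"
    and "homotopy_invariant H"
  shows "interleaving_dist D (H \<circ>\<^sub>F X) (H \<circ>\<^sub>F Y) \<le> 2 * gh_dist X Y"
proof -
  let ?I = "Inf {corr_dist (filtered_of X) (filtered_of Y) C | C.
    correspondence (total_set (filtered_of X)) (total_set (filtered_of Y)) C}"
  \<comment> \<open>Every \<epsilon> admissible for \<open>C\<close> is an interleaving parameter.
    If there is none, the right-hand side is infinite.\<close>
  have "interleaving_dist D (H \<circ>\<^sub>F X) (H \<circ>\<^sub>F Y) \<le> corr_dist (filtered_of X) (filtered_of Y) C" for C
    unfolding interleaving_dist_def corr_dist_def
    using interleaved_if_eps_correspondence[OF assms(1,2,4,5)]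
    by (intro Inf_superset_mono) blast
  then have "interleaving_dist D (H \<circ>\<^sub>F X) (H \<circ>\<^sub>F Y) \<le> ?I"
    by (intro Inf_greatest) blast
  \<comment> \<open>The factor 2 cancels the one half in the Gromov-Hausdorff distance, also when
    the infimum is infinite.\<close>
  also have "?I = 2 * (?I / 2)"
    by (simp add: ennreal_times_divide ennreal_mult_divide_eq mult.commute[of 2])
  finally show ?thesis by (simp add: gh_dist_def gh_filtered_def)
qed

end
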